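(* Let $p$ be a prime and $n$ a positive integer. Let $\mathcal F\subset 2^{[n]}$ be a $p$-wise $p$-divisible set family, where $[n]=\{1,\dots,n\}$. Then $|\mathcal F|\le 2^{\lfloor n/p\rfloor}$.
   Context: A family $\mathcal F\subset 2^{[n]}$ is called $k$-wise $\ell$-divisible if $|A_1\cap\cdots\cap A_k|$ is divisible by $\ell$ for all (not necessarily distinct) $A_1,\dots,A_k\in\mathcal F$. *)

theory Defs
  imports "HOL-Computational_Algebra.Primes"
begin

(* The sets A 1, ..., A k need not be distinct.  Intended for k \<ge> 1 and families of finite
   sets: the empty intersection is UNIV, and card is 0 on infinite sets. *)
definition kwise_divisible :: "nat \<Rightarrow> nat \<Rightarrow> 'a set set \<Rightarrow> bool" where
  "kwise_divisible k l F \<longleftrightarrow>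
     (\<forall>A :: nat \<Rightarrow> 'a set. (\<forall>i\<in>{1..k}. A i \<in> F) \<longrightarrow> l dvd card (\<Inter>i\<in>{1..k}. A i))"

end

theory Submission
  imports Defs "HOL-Library.Function_Algebras" "HOL-Library.FuncSet"
    "HOL-Computational_Algebra.Polynomial"
begin

text \<open>
  Let \<open>K\<close> be a finite field of characteristic \<open>p\<close>, large
  compared with the ground set \<open>X\<close>, and let \<open>V \<subseteq> K^X\<close> be spanned by the constant \<open>1\<close> and the
  indicators of the family. If \<open>p\<close> divides \<open>|X|\<close>, the coordinates of every product of \<open>p\<close> elements
  of \<open>V\<close> sum to \<open>0\<close>. So \<open>V\<close> is orthogonal to its power \<open>V^(p-1)\<close>, and \<open>dim V + dim V^(p-1) \<le> |X|\<close>.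
  If some power is stable under a nontrivial indicator, \<open>X\<close> splits into two blocks with the same
  property. Otherwise Kneser's inequality for codes gives \<open>dim V^(p-1) \<ge> (p-1) dim V - (p-2)\<close>, hence
  \<open>p dim V \<le> |X| + p - 2\<close>, and as \<open>p\<close> divides \<open>|X|\<close> even \<open>p dim V \<le> |X|\<close>.
  A \<open>d\<close>-dimensional space contains at most \<open>2^d\<close> vectors with entries in \<open>{0, 1}\<close>.

  If \<open>p\<close> does not divide \<open>n\<close>, pad the ground set to the next multiple of \<open>p\<close>: then \<open>V\<close> also contains
  the indicators of the complements, and this factor \<open>2\<close> pays for the padding.
\<close>

section \<open>Vectors over a finite residue field\<close>

text \<open>No type can have a variable \<open>p\<close> as its characteristic, so the field is a quotient \<open>'a / I\<close> and
  \<open>K^X\<close> consists of functions up to congruence modulo \<open>I\<close> on \<open>X\<close>. Dimensions are replaced by the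
  number \<open>sz X M\<close> of congruence classes, which is \<open>q ^ d\<close> for a space of dimension \<open>d\<close>.\<close>

locale finite_residue_field =
  fixes I :: "'a::comm_ring_1 set"
  assumes zero_I: "0 \<in> I"
    and add_I: "\<And>x y. x \<in> I \<Longrightarrow> y \<in> I \<Longrightarrow> x + y \<in> I"
    and mult_I: "\<And>a x. x \<in> I \<Longrightarrow> a * x \<in> I"
    and one_I: "1 \<notin> I"
    and inv_I: "\<And>x. x \<notin> I \<Longrightarrow> \<exists>y. x * y - 1 \<in> I"
    and finite_I: "finite (range (\<lambda>x. {y. y - x \<in> I}))"
begin

section \<open>Arithmetic modulo the ideal and canonical representatives\<close>

lemma mult_I2: "x \<in> I \<Longrightarrow> x * a \<in> I"
  using mult_I[of x a] by (simp add: mult.commute)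

lemma uminus_I: "x \<in> I \<Longrightarrow> - x \<in> I"
  using mult_I[of x "-1"] by simp

lemma diff_I: "x \<in> I \<Longrightarrow> y \<in> I \<Longrightarrow> x - y \<in> I"
  using add_I[of x "-y"] uminus_I by simp

lemma sum_I: "(\<And>i. i \<in> A \<Longrightarrow> f i \<in> I) \<Longrightarrow> sum f A \<in> I"
  by (induction A rule: infinite_finite_induct) (auto simp: zero_I add_I)

definition repr :: "'a \<Rightarrow> 'a" where
  "repr x = (SOME y. y - x \<in> I)"

lemma repr_diff: "repr x - x \<in> I"
  unfolding repr_def by (rule someI[of _ x]) (simp add: zero_I)

lemma repr_eq_iff: "repr x = repr y \<longleftrightarrow> x - y \<in> I"
proof
  assume "repr x = repr y"
  then show "x - y \<in> I"
    using diff_I[OF repr_diff[of y] repr_diff[of x]] by simp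
next
  assume xy: "x - y \<in> I"
  \<comment> \<open>\<open>SOME\<close> sees only the predicate, so congruent elements receive the
    same representative.\<close>
  have "(\<lambda>z. z - x \<in> I) = (\<lambda>z. z - y \<in> I)"
  proof
    fix z show "(z - x \<in> I) = (z - y \<in> I)"
      using add_I[OF _ xy, of "z - x"] diff_I[OF _ xy, of "z - y"] by auto
  qed
  then show "repr x = repr y" unfolding repr_def by simp
qed

lemma finite_range_repr: "finite (range repr)"
proof -
  have "repr x = (SOME y. y \<in> {y. y - x \<in> I})" for x unfolding repr_def by simp
  then have "range repr = (\<lambda>s. SOME y. y \<in> s) ` range (\<lambda>x. {y. y - x \<in> I})"
    unfolding image_image by simp
  then show ?thesis using finite_I by simp
qed

definition q :: nat where "q = card (range repr)"

lemma q_ge2: "2 \<le> q"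
proof -
  have "repr 0 \<noteq> repr 1" unfolding repr_eq_iff using one_I uminus_I[of "-1"] by auto
  then have "card {repr 0, repr 1} = 2" by simp
  moreover have "card {repr 0, repr 1} \<le> q"
    unfolding q_def by (rule card_mono[OF finite_range_repr]) auto
  ultimately show ?thesis by simp
qed

section \<open>Congruence of vectors on a coordinate set and counting of classes\<close>

definition eqv :: "'i set \<Rightarrow> ('i \<Rightarrow> 'a) \<Rightarrow> ('i \<Rightarrow> 'a) \<Rightarrow> bool" where
  "eqv X f g \<longleftrightarrow> (\<forall>i\<in>X. f i - g i \<in> I)"

lemma eqv_refl: "eqv X f f"
  by (simp add: eqv_def zero_I)

lemma eqv_sym: "eqv X f g \<Longrightarrow> eqv X g f"
  unfolding eqv_def using uminus_I by fastforce

lemma eqv_trans: "eqv X f g \<Longrightarrow> eqv X g h \<Longrightarrow> eqv X f h"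
  unfolding eqv_def using add_I by fastforce

lemma eqv_add: "eqv X f g \<Longrightarrow> eqv X f' g' \<Longrightarrow> eqv X (f + f') (g + g')"
  unfolding eqv_def using add_I by (fastforce simp: algebra_simps)

lemma eqv_diff: "eqv X f g \<Longrightarrow> eqv X f' g' \<Longrightarrow> eqv X (f - f') (g - g')"
  unfolding eqv_def using diff_I by (fastforce simp: algebra_simps)

lemma eqv_mult: "eqv X f g \<Longrightarrow> eqv X (h * f) (h * g)"
  unfolding eqv_def using mult_I by (fastforce simp: right_diff_distrib[symmetric])

lemma eqv_mult2: "eqv X f g \<Longrightarrow> eqv X (f * h) (g * h)"
  using eqv_mult[of X f g h] by (simp add: mult.commute)

text \<open>\<open>restrict\<close> gives all coordinates outside \<open>X\<close> one fixed value,
  so classes of vectors on \<open>X\<close> become plain functions that can be counted by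
  \<open>card\<close>.\<close>

definition nrm :: "'i set \<Rightarrow> ('i \<Rightarrow> 'a) \<Rightarrow> 'i \<Rightarrow> 'a" where
  "nrm X f = restrict (\<lambda>i. repr (f i)) X"

lemma nrm_eq_iff: "nrm X f = nrm X g \<longleftrightarrow> eqv X f g"
proof -
  have "nrm X f = nrm X g \<longleftrightarrow> (\<forall>i\<in>X. repr (f i) = repr (g i))"
    unfolding nrm_def restrict_def by (auto simp: fun_eq_iff)
  then show ?thesis by (simp add: repr_eq_iff eqv_def)
qed

definition sz :: "'i set \<Rightarrow> ('i \<Rightarrow> 'a) set \<Rightarrow> nat" where
  "sz X M = card (nrm X ` M)"

lemma nrm_UNIV: "nrm X ` UNIV = PiE X (\<lambda>_. range repr)"
proof
  show "nrm X ` UNIV \<subseteq> PiE X (\<lambda>_. range repr)" by (auto simp: nrm_def)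
  show "PiE X (\<lambda>_. range repr) \<subseteq> nrm X ` UNIV"
  proof
    fix g assume g: "g \<in> PiE X (\<lambda>_. range repr)"
    then have "\<forall>i\<in>X. \<exists>x. g i = repr x" by (auto simp: PiE_def Pi_def)
    then obtain f where "\<forall>i\<in>X. g i = repr (f i)" by metis
    then have "g = nrm X f" using g by (auto simp: nrm_def fun_eq_iff PiE_def extensional_def)
    then show "g \<in> nrm X ` UNIV" by simp
  qed
qed

lemma finite_nrm: "finite X \<Longrightarrow> finite (nrm X ` M)"
  by (rule finite_subset[OF image_mono[OF subset_UNIV]], unfold nrm_UNIV)
    (intro finite_PiE finite_range_repr)

lemma nrm_section:
  obtains r where "\<And>c. c \<in> nrm X ` M \<Longrightarrow> r c \<in> M \<and> nrm X (r c) = c"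
proof -
  have "\<forall>c\<in>nrm X ` M. \<exists>f. f \<in> M \<and> nrm X f = c" by auto
  then show ?thesis using that by (metis (no_types, lifting))
qed

lemma sz_UNIV: "finite X \<Longrightarrow> sz X UNIV = q ^ card X"
  unfolding sz_def nrm_UNIV by (simp add: card_PiE q_def)

lemma sz_mono: "finite X \<Longrightarrow> M \<subseteq> N \<Longrightarrow> sz X M \<le> sz X N"
  unfolding sz_def by (intro card_mono finite_nrm image_mono)

lemma sz_pos: "finite X \<Longrightarrow> f \<in> M \<Longrightarrow> sz X M > 0"
  unfolding sz_def using finite_nrm[of X M] by (auto simp: card_gt_0_iff)

lemma sz_empty:
  fixes M :: "('i \<Rightarrow> 'a) set"
  assumes "M \<noteq> {}" shows "sz {} M = 1"
proof -
  have "nrm {} f = (\<lambda>_. undefined)" for f :: "'i \<Rightarrow> 'a" by (simp add: nrm_def restrict_def)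
  then have "nrm {} ` M = {\<lambda>_. undefined}" using assms by auto
  then show ?thesis by (simp add: sz_def)
qed

text \<open>The map is applied to one chosen representative per class, so it is enough that
  \<open>\<phi>\<close> reflects congruence; it may fail to respect it.\<close>

lemma sz_inj_le:
  assumes "finite Y" and "\<And>f. f \<in> A \<Longrightarrow> \<phi> f \<in> B"
    and inj: "\<And>f g. f \<in> A \<Longrightarrow> g \<in> A \<Longrightarrow> eqv Y (\<phi> f) (\<phi> g) \<Longrightarrow> eqv X f g"
  shows "sz X A \<le> sz Y B"
proof -
  obtain r where r: "\<And>c. c \<in> nrm X ` A \<Longrightarrow> r c \<in> A \<and> nrm X (r c) = c"
    using nrm_section by blast
  have "inj_on (\<lambda>c. nrm Y (\<phi> (r c))) (nrm X ` A)"
    by (rule inj_onI) (metis inj nrm_eq_iff r)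
  moreover have "(\<lambda>c. nrm Y (\<phi> (r c))) ` (nrm X ` A) \<subseteq> nrm Y ` B"
    by (rule image_subsetI) (simp add: r assms(2))
  ultimately show ?thesis
    unfolding sz_def by (rule card_inj_on_le) (rule finite_nrm[OF assms(1)])
qed

lemma sz_Un_le:
  assumes "finite X" "finite Y" shows "sz (X \<union> Y) M \<le> sz X M * sz Y M"
proof -
  obtain r where r: "\<And>c. c \<in> nrm (X \<union> Y) ` M \<Longrightarrow> r c \<in> M \<and> nrm (X \<union> Y) (r c) = c"
    using nrm_section by blast
  have eq: "eqv (X \<union> Y) f g \<longleftrightarrow> eqv X f g \<and> eqv Y f g" for f g
    by (auto simp: eqv_def)
  have "inj_on (\<lambda>c. (nrm X (r c), nrm Y (r c))) (nrm (X \<union> Y) ` M)"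
  proof (rule inj_onI)
    fix c d assume cd: "c \<in> nrm (X \<union> Y) ` M" "d \<in> nrm (X \<union> Y) ` M"
      "(nrm X (r c), nrm Y (r c)) = (nrm X (r d), nrm Y (r d))"
    then have "nrm (X \<union> Y) (r c) = nrm (X \<union> Y) (r d)" by (simp add: nrm_eq_iff eq)
    then show "c = d" using r cd by auto
  qed
  moreover have "(\<lambda>c. (nrm X (r c), nrm Y (r c))) ` (nrm (X \<union> Y) ` M) \<subseteq> nrm X ` M \<times> nrm Y ` M"
    by (rule image_subsetI) (simp add: r)
  ultimately have "card (nrm (X \<union> Y) ` M) \<le> card (nrm X ` M \<times> nrm Y ` M)"
    by (rule card_inj_on_le) (simp add: finite_nrm assms)
  then show ?thesis by (simp add: sz_def card_cartesian_product)
qed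

text \<open>The elements are functions on the whole index type and the coordinate set enters only
  through \<open>sz\<close>, so one space can be studied on several blocks. Scalars are the constant
  functions.\<close>

definition lin :: "('i \<Rightarrow> 'a) set \<Rightarrow> bool" where
  "lin M \<longleftrightarrow> 0 \<in> M \<and> (\<forall>f\<in>M. \<forall>g\<in>M. f + g \<in> M) \<and> (\<forall>c. \<forall>f\<in>M. (\<lambda>_. c) * f \<in> M)"

lemma lin_zero: "lin M \<Longrightarrow> 0 \<in> M"
  and lin_add: "lin M \<Longrightarrow> f \<in> M \<Longrightarrow> g \<in> M \<Longrightarrow> f + g \<in> M"
  and lin_scale: "lin M \<Longrightarrow> f \<in> M \<Longrightarrow> (\<lambda>_. c) * f \<in> M"
  by (auto simp: lin_def)

lemma lin_diff: "lin M \<Longrightarrow> f \<in> M \<Longrightarrow> g \<in> M \<Longrightarrow> f - g \<in> M"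
proof -
  assume a: "lin M" "f \<in> M" "g \<in> M"
  have "f + (\<lambda>_. -1) * g \<in> M" using a by (intro lin_add lin_scale)
  moreover have "f + (\<lambda>_. -1) * g = f - g" by (simp add: fun_eq_iff)
  ultimately show ?thesis by simp
qed

section \<open>Elimination of one coordinate\<close>

lemma sz_insert_eq:
  assumes "\<And>m. m \<in> M \<Longrightarrow> m x \<in> I" "finite X"
  shows "sz (insert x X) M = sz X M"
proof (rule antisym)
  show "sz (insert x X) M \<le> sz X M"
    by (rule sz_inj_le[where \<phi> = id]) (use assms in \<open>auto simp: eqv_def diff_I\<close>)
  show "sz X M \<le> sz (insert x X) M"
    by (rule sz_inj_le[where \<phi> = id]) (use assms in \<open>auto simp: eqv_def\<close>)
qed

lemma lin_normalised:
  assumes "lin M" "m \<in> M" "m x \<notin> I"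
  obtains u where "u \<in> M" "u x - 1 \<in> I"
proof -
  obtain y where "m x * y - 1 \<in> I" using inv_I[OF assms(3)] by blast
  then show ?thesis using that[of "(\<lambda>_. y) * m"] assms lin_scale by (auto simp: mult.commute)
qed

text \<open>Rank-nullity for evaluation at \<open>x\<close>: as \<open>u\<close> is 1 there modulo
  \<open>I\<close>, every element of \<open>M\<close> is a multiple of \<open>u\<close> plus an
  element of the kernel, and the multiplier is determined modulo \<open>I\<close>.\<close>

lemma sz_insert_pivot:
  assumes M: "lin M" and u: "u \<in> M" "u x - 1 \<in> I" and X: "finite X"
  shows "sz (insert x X) M = q * sz X {m \<in> M. m x \<in> I}"
proof -
  let ?M0 = "{m \<in> M. m x \<in> I}"
  have part: "m - (\<lambda>_. m x) * u \<in> ?M0" if "m \<in> M" for m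
  proof -
    have "m x - m x * u x = - (m x * (u x - 1))" by (simp add: algebra_simps)
    then show ?thesis using that M u by (auto intro!: lin_diff lin_scale uminus_I mult_I)
  qed
  have ueq: "c * u x - c \<in> I" for c
    using mult_I[OF u(2), of c] by (simp add: algebra_simps)
  obtain r where r: "\<And>c. c \<in> nrm X ` ?M0 \<Longrightarrow> r c \<in> ?M0 \<and> nrm X (r c) = c"
    using nrm_section by blast
  define h where "h = (\<lambda>(a, c). nrm (insert x X) ((\<lambda>_. a) * u + r c))"
  have "inj_on h (range repr \<times> nrm X ` ?M0)"
  proof (rule inj_onI, clarify)
    fix a b f g assume f: "f \<in> M" "f x \<in> I" and g: "g \<in> M" "g x \<in> I"
      and h: "h (repr a, nrm X f) = h (repr b, nrm X g)"
    define f' g' where "f' = r (nrm X f)" and "g' = r (nrm X g)"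
    have f': "f' x \<in> I" "nrm X f' = nrm X f" and g': "g' x \<in> I" "nrm X g' = nrm X g"
      unfolding f'_def g'_def using f g r by blast+
    have E: "eqv (insert x X) ((\<lambda>_. repr a) * u + f') ((\<lambda>_. repr b) * u + g')"
      using h unfolding h_def f'_def g'_def by (simp add: nrm_eq_iff)
    have "repr a * u x + f' x - (repr b * u x + g' x) \<in> I"
      using E by (auto simp: eqv_def)
    moreover have "repr a - repr b = (repr a * u x + f' x - (repr b * u x + g' x))
        - (repr a * u x - repr a) + (repr b * u x - repr b) - f' x + g' x"
      by (simp add: algebra_simps)
    ultimately have "repr a - repr b \<in> I"
      using ueq f'(1) g'(1) by (metis add_I diff_I)
    then have "repr (repr a) = repr (repr b)" by (simp add: repr_eq_iff)
    moreover have "repr (repr c) = repr c" for c using repr_diff by (simp add: repr_eq_iff)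
    ultimately have ab: "repr a = repr b" by simp
    then have "eqv X f' g'" using E by (auto simp: eqv_def)
    then have "nrm X f = nrm X g" using f'(2) g'(2) by (simp add: nrm_eq_iff[symmetric])
    then show "repr a = repr b \<and> nrm X f = nrm X g" using ab by simp
  qed
  moreover have "h ` (range repr \<times> nrm X ` ?M0) = nrm (insert x X) ` M"
  proof
    show "h ` (range repr \<times> nrm X ` ?M0) \<subseteq> nrm (insert x X) ` M"
    proof (clarify)
      fix a f assume "f \<in> M" "f x \<in> I"
      then have "r (nrm X f) \<in> M" using r by blast
      then show "h (repr a, nrm X f) \<in> nrm (insert x X) ` M"
        unfolding h_def using M u by (auto intro!: imageI lin_add lin_scale)
    qed
    show "nrm (insert x X) ` M \<subseteq> h ` (range repr \<times> nrm X ` ?M0)"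
    proof
      fix z assume "z \<in> nrm (insert x X) ` M"
      then obtain m where m: "m \<in> M" "z = nrm (insert x X) m" by blast
      define f where "f = m - (\<lambda>_. repr (m x)) * u"
      have "m x - repr (m x) * u x = - (repr (m x) - m x) - (repr (m x) * u x - repr (m x))"
        by (simp add: algebra_simps)
      also have "\<dots> \<in> I" by (intro diff_I uminus_I repr_diff ueq)
      finally have f: "f \<in> ?M0" unfolding f_def using m M u by (auto intro!: lin_diff lin_scale)
      define f' where "f' = r (nrm X f)"
      have f': "f' \<in> ?M0" "nrm X f' = nrm X f" unfolding f'_def using r f by blast+
      have "eqv (insert x X) f' f"
        using f f' by (auto simp: nrm_eq_iff eqv_def diff_I)
      then have "eqv (insert x X) ((\<lambda>_. repr (m x)) * u + f') ((\<lambda>_. repr (m x)) * u + f)"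
        by (intro eqv_add eqv_refl)
      moreover have "(\<lambda>_. repr (m x)) * u + f = m" by (simp add: f_def)
      ultimately have "z = h (repr (m x), nrm X f)"
        using m(2) unfolding h_def f'_def by (simp add: nrm_eq_iff eqv_sym)
      then show "z \<in> h ` (range repr \<times> nrm X ` ?M0)" using f by blast
    qed
  qed
  ultimately have "bij_betw h (range repr \<times> nrm X ` ?M0) (nrm (insert x X) ` M)"
    unfolding bij_betw_def by (rule conjI)
  from bij_betw_same_card[OF this] show ?thesis by (simp add: sz_def q_def card_cartesian_product)
qed

lemma lin_pivot_kernel: "lin M \<Longrightarrow> lin {m \<in> M. m x \<in> I}"
  by (auto simp: lin_def zero_I add_I mult_I)

section \<open>Zero-one vectors in affine spaces\<close>

definition ind :: "'i set \<Rightarrow> 'i \<Rightarrow> 'a" where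
  "ind A i = (if i \<in> A then 1 else 0)"

text \<open>The translation by \<open>w\<close> serves the induction on coordinates: prescribing the
  value at a pivot turns a linear space into an affine one.\<close>

definition boolean_in :: "'i set \<Rightarrow> ('i \<Rightarrow> 'a) set \<Rightarrow> ('i \<Rightarrow> 'a) \<Rightarrow> 'i set set" where
  "boolean_in X M w = {A. A \<subseteq> X \<and> (\<exists>m\<in>M. eqv X (ind A) (m + w))}"

text \<open>Both claims share the exponent \<open>d\<close>, so one induction proves them: a pivot
  coordinate multiplies the size by \<open>q\<close> but leaves a zero-one vector only two choices,
  and a coordinate where \<open>M\<close> vanishes contributes to neither count.\<close>

lemma sz_power_boolean:
  fixes M :: "('i \<Rightarrow> 'a) set"
  assumes "finite X" "lin M"
  shows "\<exists>d. sz X M = q ^ d \<and> (\<forall>w. card (boolean_in X M w) \<le> 2 ^ d)"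
  using assms
proof (induction X arbitrary: M rule: finite_induct)
  case empty
  have "card (boolean_in {} M w) \<le> 1" for w
    using card_mono[of "{{}}" "boolean_in {} M w"] by (auto simp: boolean_in_def)
  moreover have "sz {} M = 1" using sz_empty lin_zero[OF empty] by blast
  ultimately show ?case by (intro exI[of _ 0]) simp
next
  case (insert x X)
  have fin: "finite (boolean_in X N w)" for N :: "('i \<Rightarrow> 'a) set" and w
    unfolding boolean_in_def using insert(1) by simp
  show ?case
  proof (cases "\<forall>m\<in>M. m x \<in> I")
    case True
    obtain d where d: "sz X M = q ^ d" "\<And>w. card (boolean_in X M w) \<le> 2 ^ d"
      using insert.IH[OF insert.prems] by blast
    have "card (boolean_in (insert x X) M w) \<le> 2 ^ d" for w
    proof -
      \<comment> \<open>As \<open>M\<close> vanishes at \<open>x\<close>, a zero-one vector is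
        congruent to \<open>w\<close> there, which decides membership of \<open>x\<close>.\<close>
      have "inj_on (\<lambda>A. A - {x}) (boolean_in (insert x X) M w)"
      proof (rule inj_onI)
        fix A B assume A: "A \<in> boolean_in (insert x X) M w" and B: "B \<in> boolean_in (insert x X) M w"
          and AB: "A - {x} = B - {x}"
        obtain m m' where m: "m \<in> M" "eqv (insert x X) (ind A) (m + w)"
          "m' \<in> M" "eqv (insert x X) (ind B) (m' + w)"
          using A B by (auto simp: boolean_in_def)
        have "ind A x - ind B x = (ind A x - (m x + w x)) - (ind B x - (m' x + w x)) + m x - m' x"
          by (simp add: algebra_simps)
        also have "\<dots> \<in> I"
        proof -
          have "ind A x - (m x + w x) \<in> I" "ind B x - (m' x + w x) \<in> I" "m x \<in> I" "m' x \<in> I"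
            using m True by (auto simp: eqv_def)
          then show ?thesis by (metis diff_I add_I)
        qed
        finally have "ind A x - ind B x \<in> I" .
        moreover have "-1 \<notin> I" using uminus_I one_I by fastforce
        ultimately have "x \<in> A \<longleftrightarrow> x \<in> B" using one_I by (auto simp: ind_def split: if_splits)
        then show "A = B" using AB by blast
      qed
      moreover have "(\<lambda>A. A - {x}) ` boolean_in (insert x X) M w \<subseteq> boolean_in X M w"
      proof (clarify)
        fix A assume "A \<in> boolean_in (insert x X) M w"
        then obtain m where m: "A \<subseteq> insert x X" "m \<in> M" "eqv (insert x X) (ind A) (m + w)"
          by (auto simp: boolean_in_def)
        have "eqv X (ind (A - {x})) (m + w)"
          using m(3) insert(2) by (auto simp: eqv_def ind_def)
        then show "A - {x} \<in> boolean_in X M w" using m by (auto simp: boolean_in_def)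
      qed
      ultimately have "card (boolean_in (insert x X) M w) \<le> card (boolean_in X M w)"
        by (rule card_inj_on_le) (rule fin)
      then show ?thesis using d(2)[of w] by simp
    qed
    moreover have "sz (insert x X) M = q ^ d"
      using sz_insert_eq[of M x X] True insert(1) d(1) by simp
    ultimately show ?thesis by blast
  next
    case False
    then obtain u where u: "u \<in> M" "u x - 1 \<in> I" using lin_normalised insert.prems by metis
    let ?M0 = "{m \<in> M. m x \<in> I}"
    obtain d where d: "sz X ?M0 = q ^ d" "\<And>w. card (boolean_in X ?M0 w) \<le> 2 ^ d"
      using insert.IH[OF lin_pivot_kernel[OF insert.prems, of x]] by blast
    have sz: "sz (insert x X) M = q ^ Suc d"
      using sz_insert_pivot[OF insert.prems u insert(1)] d(1) by simp
    have "card (boolean_in (insert x X) M w) \<le> 2 ^ Suc d" for w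
    proof -
      \<comment> \<open>Modulo \<open>I\<close>, \<open>W b\<close> has the value \<open>b\<close>
        at \<open>x\<close>; the sets containing \<open>x\<close> are counted through
        \<open>W 1\<close>, the others through \<open>W 0\<close>.\<close>
      define W where "W b = w + (\<lambda>_. b - w x) * u" for b
      have key: "A - {x} \<in> boolean_in X ?M0 (W (ind A x))"
        if A: "A \<in> boolean_in (insert x X) M w" for A
      proof -
        obtain m where m: "A \<subseteq> insert x X" "m \<in> M" "eqv (insert x X) (ind A) (m + w)"
          using A by (auto simp: boolean_in_def)
        define m0 where "m0 = m - (\<lambda>_. ind A x - w x) * u"
        have "m0 x = - (ind A x - (m x + w x)) - (ind A x - w x) * (u x - 1)"
          by (simp add: m0_def algebra_simps)
        also have "\<dots> \<in> I"
        proof -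
          have "ind A x - (m x + w x) \<in> I" using m by (auto simp: eqv_def)
          then show ?thesis using u by (metis diff_I uminus_I mult_I)
        qed
        finally have "m0 x \<in> I" .
        moreover have "m0 \<in> M" unfolding m0_def using m u insert.prems
          by (intro lin_diff lin_scale)
        moreover have "m0 + W (ind A x) = m + w"
          by (simp add: m0_def W_def algebra_simps)
        moreover have "eqv X (ind (A - {x})) (m + w)"
          using m(3) insert(2) by (auto simp: eqv_def ind_def)
        ultimately show ?thesis using m(1) by (auto simp: boolean_in_def)
      qed
      have "inj_on (\<lambda>A. (x \<in> A, A - {x})) (boolean_in (insert x X) M w)"
        by (rule inj_onI) blast
      then have "card (boolean_in (insert x X) M w)
          = card ((\<lambda>A. (x \<in> A, A - {x})) ` boolean_in (insert x X) M w)"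
        by (simp add: card_image)
      also have "\<dots> \<le> card ({True} \<times> boolean_in X ?M0 (W 1) \<union> {False} \<times> boolean_in X ?M0 (W 0))"
      proof (rule card_mono)
        show "(\<lambda>A. (x \<in> A, A - {x})) ` boolean_in (insert x X) M w
            \<subseteq> {True} \<times> boolean_in X ?M0 (W 1) \<union> {False} \<times> boolean_in X ?M0 (W 0)"
        proof (rule image_subsetI)
          fix A assume "A \<in> boolean_in (insert x X) M w"
          then show "(x \<in> A, A - {x})
              \<in> {True} \<times> boolean_in X ?M0 (W 1) \<union> {False} \<times> boolean_in X ?M0 (W 0)"
            using key[of A] by (cases "x \<in> A") (auto simp: ind_def)
        qed
      qed (use fin in simp)
      also have "\<dots> \<le> card ({True} \<times> boolean_in X ?M0 (W 1)) + card ({False} \<times> boolean_in X ?M0 (W 0))"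
        by (rule card_Un_le)
      also have "\<dots> \<le> 2 ^ d + 2 ^ d"
        using d(2)[of "W 1"] d(2)[of "W 0"] by (simp add: card_cartesian_product)
      finally show ?thesis by simp
    qed
    then show ?thesis using sz by blast
  qed
qed

text \<open>Induction on coordinates. If \<open>U\<close> vanishes at \<open>x\<close>, only
  \<open>U'\<close> can lose a factor \<open>q\<close> when \<open>x\<close> is dropped. Otherwise
  \<open>U\<close> loses that factor by passing to the kernel at \<open>x\<close>, and orthogonality
  to a pivot determines an element of \<open>U'\<close> from its other coordinates.\<close>

lemma sz_orthogonal:
  fixes U U' :: "('i \<Rightarrow> 'a) set"
  assumes "finite X" "lin U" "lin U'"
    and "\<And>f g. f \<in> U \<Longrightarrow> g \<in> U' \<Longrightarrow> (\<Sum>i\<in>X. f i * g i) \<in> I"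
  shows "sz X U * sz X U' \<le> q ^ card X"
  using assms
proof (induction X arbitrary: U U' rule: finite_induct)
  case empty
  have "sz {} U = 1" "sz {} U' = 1" using sz_empty lin_zero empty by blast+
  then show ?case by simp
next
  case (insert x X)
  have sum: "(\<Sum>i\<in>insert x X. f i * g i) = f x * g x + (\<Sum>i\<in>X. f i * g i)" for f g :: "'i \<Rightarrow> 'a"
    using insert by simp
  have orth: "f x * g x + (\<Sum>i\<in>X. f i * g i) \<in> I" if "f \<in> U" "g \<in> U'" for f g
    using insert.prems(3)[OF that] sum by metis
  have rest: "(\<Sum>i\<in>X. f i * g i) \<in> I" if "f \<in> U" "g \<in> U'" "f x \<in> I" for f g
    using diff_I[OF orth[OF that(1,2)] mult_I2[OF that(3), of "g x"]] by simp
  show ?case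
  proof (cases "\<forall>m\<in>U. m x \<in> I")
    case True
    have "sz X U * sz X U' \<le> q ^ card X"
      using True rest by (intro insert.IH insert.prems) auto
    moreover have "sz (insert x X) U = sz X U"
      by (rule sz_insert_eq) (use True insert(1) in auto)
    moreover have "sz (insert x X) U' \<le> q * sz X U'"
    proof -
      have "sz ({x} \<union> X) U' \<le> sz {x} U' * sz X U'" by (rule sz_Un_le) (use insert in auto)
      also have "sz {x} U' \<le> q" using sz_mono[of "{x}" U' UNIV] sz_UNIV[of "{x}"] by simp
      finally show ?thesis by simp
    qed
    ultimately have "sz (insert x X) U * sz (insert x X) U' \<le> sz X U * (q * sz X U')" by simp
    also have "\<dots> \<le> q * q ^ card X" using \<open>sz X U * sz X U' \<le> q ^ card X\<close> by simp
    finally show ?thesis using insert by simp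
  next
    case False
    then obtain u where u: "u \<in> U" "u x - 1 \<in> I" using lin_normalised insert.prems by metis
    let ?U0 = "{m \<in> U. m x \<in> I}"
    have "sz X ?U0 * sz X U' \<le> q ^ card X"
      using insert.prems rest by (intro insert.IH lin_pivot_kernel) auto
    moreover have "sz (insert x X) U = q * sz X ?U0"
      using sz_insert_pivot[OF insert.prems(1) u insert(1)] .
    moreover have "sz (insert x X) U' \<le> sz X U'"
    proof (rule sz_inj_le[where \<phi> = id])
      fix f g assume f: "f \<in> U'" and g: "g \<in> U'" and "eqv X (id f) (id g)"
      then have e: "\<forall>i\<in>X. (f - g) i \<in> I" by (simp add: eqv_def)
      have fg: "f - g \<in> U'" using f g insert.prems lin_diff by blast
      \<comment> \<open>With \<open>f - g\<close> vanishing on \<open>X\<close>, orthogonality to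
        \<open>u\<close> leaves only the term at \<open>x\<close>, where \<open>u\<close> is 1
        modulo \<open>I\<close>.\<close>
      have "(\<Sum>i\<in>X. u i * (f - g) i) \<in> I" using e by (intro sum_I mult_I) simp
      then have "u x * (f - g) x \<in> I" using diff_I[OF orth[OF u(1) fg]] by fastforce
      then have "u x * (f - g) x - (u x - 1) * (f - g) x \<in> I"
        by (rule diff_I[OF _ mult_I2[OF u(2)]])
      moreover have "u x * (f - g) x - (u x - 1) * (f - g) x = (f - g) x" by (simp add: algebra_simps)
      ultimately show "eqv (insert x X) f g" using e by (auto simp: eqv_def)
    qed (use insert in auto)
    ultimately have "sz (insert x X) U * sz (insert x X) U' \<le> q * sz X ?U0 * sz X U'" by simp
    also have "\<dots> \<le> q * q ^ card X"
      using \<open>sz X ?U0 * sz X U' \<le> q ^ card X\<close> by (simp add: mult.assoc)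
    finally show ?thesis using insert by simp
  qed
qed

section \<open>Kneser's inequality up to splitting off a block\<close>

text \<open>Saturation makes membership a property of the congruence class, so these sets correspond
  to the subspaces of the quotient space.\<close>

definition sub :: "'i set \<Rightarrow> ('i \<Rightarrow> 'a) set \<Rightarrow> bool" where
  "sub X M \<longleftrightarrow> lin M \<and> (\<forall>f\<in>M. \<forall>g. eqv X g f \<longrightarrow> g \<in> M)"

lemma sub_lin: "sub X M \<Longrightarrow> lin M"
  and sub_eqv: "sub X M \<Longrightarrow> f \<in> M \<Longrightarrow> eqv X g f \<Longrightarrow> g \<in> M"
  by (auto simp: sub_def)

definition cl :: "'i set \<Rightarrow> ('i \<Rightarrow> 'a) set \<Rightarrow> ('i \<Rightarrow> 'a) set" where
  "cl X M = {f. \<exists>m\<in>M. eqv X f m}"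

lemma cl_superset: "M \<subseteq> cl X M"
  unfolding cl_def using eqv_refl by blast

lemma sub_cl: "lin M \<Longrightarrow> sub X (cl X M)"
  unfolding sub_def
proof (intro conjI)
  assume M: "lin M"
  show "lin (cl X M)"
    unfolding lin_def
  proof (intro conjI ballI allI)
    show "0 \<in> cl X M" using cl_superset lin_zero[OF M] by blast
  next
    fix f g assume "f \<in> cl X M" "g \<in> cl X M"
    then obtain f' g' where "f' \<in> M" "eqv X f f'" "g' \<in> M" "eqv X g g'" by (auto simp: cl_def)
    then show "f + g \<in> cl X M" unfolding cl_def using eqv_add lin_add[OF M] by blast
  next
    fix c f assume "f \<in> cl X M"
    then obtain f' where "f' \<in> M" "eqv X f f'" by (auto simp: cl_def)
    then show "(\<lambda>_. c) * f \<in> cl X M" unfolding cl_def using eqv_mult lin_scale[OF M] by blast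
  qed
  show "\<forall>f\<in>cl X M. \<forall>g. eqv X g f \<longrightarrow> g \<in> cl X M"
    unfolding cl_def using eqv_trans by blast
qed

lemma sz_cl: "sz X (cl X M) = sz X M"
proof -
  have "nrm X ` cl X M = nrm X ` M"
  proof
    show "nrm X ` cl X M \<subseteq> nrm X ` M"
    proof (rule image_subsetI)
      fix f assume "f \<in> cl X M"
      then obtain m where "m \<in> M" "eqv X f m" by (auto simp: cl_def)
      then show "nrm X f \<in> nrm X ` M" by (metis image_eqI nrm_eq_iff)
    qed
    show "nrm X ` M \<subseteq> nrm X ` cl X M" using cl_superset by (rule image_mono)
  qed
  then show ?thesis by (simp add: sz_def)
qed

text \<open>Saturation keeps the whole class of \<open>f\<close> outside \<open>M\<close>.\<close>

lemma sz_psubset: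
  assumes "finite X" "sub X M" "M \<subseteq> N" "f \<in> N" "f \<notin> M"
  shows "sz X M < sz X N"
proof -
  have "nrm X f \<notin> nrm X ` M"
  proof
    assume "nrm X f \<in> nrm X ` M"
    then obtain m where "m \<in> M" "eqv X f m" by (auto simp: nrm_eq_iff)
    then show False using sub_eqv[OF assms(2)] assms(5) by blast
  qed
  then have "nrm X ` M \<subset> nrm X ` N" using assms(3,4) by blast
  then show ?thesis unfolding sz_def by (rule psubset_card_mono[OF finite_nrm[OF assms(1)]])
qed

text \<open>Rank-nullity for multiplication by \<open>t\<close> as a map from \<open>S\<close> to (T
  + tS)/T, whose kernel is the first set on the right. The proof is an explicit injection between
  pairs of classes.\<close>

lemma sz_image_kernel:
  assumes X: "finite X" and S: "sub X S" and T: "sub X T"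
  shows "sz X S * sz X T
    \<le> sz X {s \<in> S. t * s \<in> T} * sz X {g. \<exists>f\<in>T. \<exists>s\<in>S. g = f + t * s}"
    (is "_ \<le> sz X ?K * sz X ?T'")
proof -
  obtain rS where rS: "\<And>c. c \<in> nrm X ` S \<Longrightarrow> rS c \<in> S \<and> nrm X (rS c) = c"
    using nrm_section by blast
  obtain rT where rT: "\<And>c. c \<in> nrm X ` T \<Longrightarrow> rT c \<in> T \<and> nrm X (rT c) = c"
    using nrm_section by blast
  have "\<forall>c\<in>nrm X ` ?T'. \<exists>s. s \<in> S \<and> (\<exists>f\<in>T. nrm X (f + t * s) = c)" by blast
  \<comment> \<open>\<open>\<sigma>\<close> picks for each class of T + tS an element of
    \<open>S\<close> whose multiple by \<open>t\<close> represents that class modulo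
    \<open>T\<close>; subtracting it leaves an element of the kernel.\<close>
  then obtain \<sigma> where \<sigma>: "\<And>c. c \<in> nrm X ` ?T' \<Longrightarrow> \<sigma> c \<in> S \<and> (\<exists>f\<in>T. nrm X (f + t * \<sigma> c) = c)"
    by (metis (no_types, lifting))
  define h where "h = (\<lambda>(a, b). let c = nrm X (rT b + t * rS a) in (nrm X (rS a - \<sigma> c), c))"
  have c: "nrm X (rT b + t * rS a) \<in> nrm X ` ?T'" if "a \<in> nrm X ` S" "b \<in> nrm X ` T" for a b
    using rS[OF that(1)] rT[OF that(2)] by blast
  have "inj_on h (nrm X ` S \<times> nrm X ` T)"
  proof (rule inj_onI)
    fix y z assume y: "y \<in> nrm X ` S \<times> nrm X ` T" and z: "z \<in> nrm X ` S \<times> nrm X ` T"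
      and h: "h y = h z"
    obtain a b a' b' where ab: "y = (a, b)" "z = (a', b')" by (metis surj_pair)
    define d d' where "d = nrm X (rT b + t * rS a)" and "d' = nrm X (rT b' + t * rS a')"
    have hh: "nrm X (rS a - \<sigma> d) = nrm X (rS a' - \<sigma> d') \<and> d = d'"
      using h unfolding ab h_def d_def d'_def case_prod_conv Let_def prod.inject .
    then have e: "nrm X (rS a - \<sigma> d) = nrm X (rS a' - \<sigma> d)" by metis
    have d: "d = nrm X (rT b' + t * rS a')" using hh unfolding d'_def by (rule conjunct2)
    have "eqv X (rS a - \<sigma> d + \<sigma> d) (rS a' - \<sigma> d + \<sigma> d)"
      using e unfolding nrm_eq_iff by (rule eqv_add) (rule eqv_refl)
    then have ea: "eqv X (rS a) (rS a')" by simp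
    have "eqv X (rT b + t * rS a) (rT b' + t * rS a')"
      using d unfolding d_def nrm_eq_iff .
    then have "eqv X (rT b + t * rS a - t * rS a) (rT b' + t * rS a' - t * rS a')"
      by (rule eqv_diff) (rule eqv_mult[OF ea])
    then have "eqv X (rT b) (rT b')" by simp
    then have "nrm X (rT b) = nrm X (rT b')" "nrm X (rS a) = nrm X (rS a')"
      using ea by (simp_all only: nrm_eq_iff)
    moreover have "nrm X (rS a) = a" "nrm X (rS a') = a'" "nrm X (rT b) = b" "nrm X (rT b') = b'"
      using y z rS rT unfolding ab by blast+
    ultimately show "y = z" unfolding ab by metis
  qed
  moreover have "h ` (nrm X ` S \<times> nrm X ` T) \<subseteq> nrm X ` ?K \<times> nrm X ` ?T'"
  proof (rule image_subsetI)
    fix y assume y: "y \<in> nrm X ` S \<times> nrm X ` T"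
    obtain a b where ab: "y = (a, b)" by (metis surj_pair)
    have a: "a \<in> nrm X ` S" and b: "b \<in> nrm X ` T" using y ab by auto
    define d where "d = nrm X (rT b + t * rS a)"
    have d: "d \<in> nrm X ` ?T'" unfolding d_def by (rule c[OF a b])
    obtain f where f: "f \<in> T" "nrm X (f + t * \<sigma> d) = d" using \<sigma>[OF d] by blast
    have "eqv X (f + t * \<sigma> d) (rT b + t * rS a)" using f(2) unfolding d_def nrm_eq_iff .
    then have "eqv X (f + t * \<sigma> d - (rT b + t * \<sigma> d)) (rT b + t * rS a - (rT b + t * \<sigma> d))"
      by (rule eqv_diff) (rule eqv_refl)
    then have "eqv X (t * (rS a - \<sigma> d)) (f - rT b)"
      by (intro eqv_sym[of X "f - rT b"]) (simp add: algebra_simps)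
    moreover have "f - rT b \<in> T" using f(1) rT[OF b] lin_diff[OF sub_lin[OF T]] by blast
    ultimately have "t * (rS a - \<sigma> d) \<in> T" using sub_eqv[OF T] by blast
    moreover have "rS a - \<sigma> d \<in> S" using rS[OF a] \<sigma>[OF d] lin_diff[OF sub_lin[OF S]] by blast
    ultimately have "rS a - \<sigma> d \<in> ?K" by simp
    moreover have "h y = (nrm X (rS a - \<sigma> d), d)" unfolding ab h_def d_def by (simp add: Let_def)
    ultimately show "h y \<in> nrm X ` ?K \<times> nrm X ` ?T'" using d by simp
  qed
  ultimately have "card (nrm X ` S \<times> nrm X ` T) \<le> card (nrm X ` ?K \<times> nrm X ` ?T')"
    by (rule card_inj_on_le) (simp add: finite_nrm X)
  then show ?thesis by (simp add: sz_def card_cartesian_product)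
qed

lemma eqv_fun_diff: "eqv X f g \<Longrightarrow> eqv X (f - h) (g - h)"
  by (rule eqv_diff) (auto intro: eqv_refl)

lemma sub_kernel:
  assumes S: "sub X S" and T: "sub X T"
  shows "sub X {s \<in> S. t * s \<in> T}"
  unfolding sub_def lin_def
proof (intro conjI ballI allI impI)
  show "0 \<in> {s \<in> S. t * s \<in> T}" using S T by (simp add: lin_zero sub_lin)
next
  fix f g assume "f \<in> {s \<in> S. t * s \<in> T}" "g \<in> {s \<in> S. t * s \<in> T}"
  then show "f + g \<in> {s \<in> S. t * s \<in> T}"
    using S T by (simp add: distrib_left lin_add sub_lin)
next
  fix c f assume "f \<in> {s \<in> S. t * s \<in> T}"
  then show "(\<lambda>_. c) * f \<in> {s \<in> S. t * s \<in> T}"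
    using S T by (simp add: mult.left_commute[of t] lin_scale sub_lin)
next
  fix f g assume "f \<in> {s \<in> S. t * s \<in> T}" "eqv X g f"
  then show "g \<in> {s \<in> S. t * s \<in> T}"
    using sub_eqv[OF S] sub_eqv[OF T] eqv_mult by blast
qed

lemma sub_preimage: "sub X M \<Longrightarrow> sub X {f. r * f \<in> M}"
  using sub_kernel[of X UNIV M r] by (simp add: sub_def[of X UNIV] lin_def[of UNIV])

lemma sub_translate_sum:
  assumes S: "sub X S" and T: "sub X T"
  shows "sub X {g. \<exists>f\<in>T. \<exists>s\<in>S. g = f + t * s}" (is "sub X ?T'")
  unfolding sub_def lin_def
proof (intro conjI ballI allI impI)
  have "0 = 0 + t * 0" by simp
  then show "0 \<in> ?T'" using S T lin_zero sub_lin by blast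
next
  fix f g assume "f \<in> ?T'" "g \<in> ?T'"
  then obtain f' s g' r where fg: "f' \<in> T" "s \<in> S" "f = f' + t * s" "g' \<in> T" "r \<in> S" "g = g' + t * r"
    by blast
  have "f + g = (f' + g') + t * (s + r)" using fg by (simp add: algebra_simps)
  then show "f + g \<in> ?T'" using fg S T lin_add sub_lin by blast
next
  fix c f assume "f \<in> ?T'"
  then obtain f' s where f: "f' \<in> T" "s \<in> S" "f = f' + t * s" by blast
  have "(\<lambda>_. c) * f = (\<lambda>_. c) * f' + t * ((\<lambda>_. c) * s)" using f by (simp add: algebra_simps)
  then show "(\<lambda>_. c) * f \<in> ?T'" using f S T lin_scale sub_lin by blast
next
  fix f g assume "f \<in> ?T'" and e: "eqv X g f"
  then obtain f' s where f: "f' \<in> T" "s \<in> S" "f = f' + t * s" by blast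
  have "eqv X (g - t * s) (f - t * s)" using e by (rule eqv_fun_diff)
  then have "eqv X (g - t * s) f'" using f by simp
  then have "g - t * s \<in> T" using sub_eqv[OF T f(1)] by blast
  moreover have "g = (g - t * s) + t * s" by simp
  ultimately show "g \<in> ?T'" using f by blast
qed

text \<open>The linear analogue of the Dyson e-transform: replacing \<open>(S, T)\<close> by
  \<open>({s \<in> S. t s \<in> T}, T + t S)\<close> preserves the total dimension and does not
  leave \<open>P\<close>.\<close>

lemma transform_exhaust:
  assumes X: "finite X" and P: "sub X P"
    and "sub X S" "sub X T" "1 \<in> S" "\<And>s t. s \<in> S \<Longrightarrow> t \<in> T \<Longrightarrow> s * t \<in> P"
  shows "\<exists>S' T'. sub X T' \<and> 1 \<in> S' \<and> T \<subseteq> T' \<and> T' \<subseteq> P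
    \<and> (\<forall>s\<in>S'. \<forall>t\<in>T'. s * t \<in> T') \<and> sz X S * sz X T \<le> sz X S' * sz X T'"
  using assms(3-)
proof (induction "sz X S" arbitrary: S T rule: less_induct)
  case less
  note S = less.prems(1) and T = less.prems(2)
  show ?case
  proof (cases "\<forall>s\<in>S. \<forall>t\<in>T. s * t \<in> T")
    case True
    have "T \<subseteq> P" using less.prems(4)[OF less.prems(3)] by auto
    then show ?thesis using True less.prems by blast
  next
    case False
    then obtain s0 t where s0: "s0 \<in> S" and t: "t \<in> T" and st: "s0 * t \<notin> T" by blast
    let ?K = "{s \<in> S. t * s \<in> T}" and ?T' = "{g. \<exists>f\<in>T. \<exists>s\<in>S. g = f + t * s}"
    have K: "sub X ?K" and T': "sub X ?T'" using sub_kernel sub_translate_sum S T by blast+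
    have "s0 \<notin> ?K" using st by (simp add: mult.commute)
    then have "sz X ?K < sz X S" using sz_psubset[OF X K _ s0] by blast
    moreover have "1 \<in> ?K" using less.prems(3) t by simp
    \<comment> \<open>Since \<open>t * s\<close> lies in \<open>T\<close>, both terms of
      \<open>s * f + r * (t * s)\<close> are products of an element of \<open>S\<close> and one of
      \<open>T\<close>.\<close>
    moreover have "s * g \<in> P" if sg: "s \<in> ?K" "g \<in> ?T'" for s g
    proof -
      obtain f r where g: "f \<in> T" "r \<in> S" "g = f + t * r" using sg(2) by blast
      have "s * f \<in> P" "r * (t * s) \<in> P" using sg(1) g less.prems(4) by blast+
      moreover have "s * g = s * f + r * (t * s)" unfolding g(3) by (simp add: algebra_simps)
      ultimately show ?thesis using lin_add[OF sub_lin[OF P]] by simp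
    qed
    ultimately obtain S' T'' where *: "sub X T''" "1 \<in> S'" "?T' \<subseteq> T''" "T'' \<subseteq> P"
      "\<forall>s\<in>S'. \<forall>t\<in>T''. s * t \<in> T''" "sz X ?K * sz X ?T' \<le> sz X S' * sz X T''"
      using less.hyps[of ?K ?T'] K T' by blast
    have "f = f + t * 0" for f :: "'b \<Rightarrow> 'a" by simp
    then have "T \<subseteq> ?T'" using lin_zero[OF sub_lin[OF S]] by blast
    moreover have "sz X S * sz X T \<le> sz X S' * sz X T''"
      using sz_image_kernel[OF X S T, of t] *(6) by (rule order_trans)
    ultimately show ?thesis using * by blast
  qed
qed

text \<open>The indicator of a level set of \<open>h\<close> is, modulo \<open>I\<close>, a
  polynomial in \<open>h\<close>, namely a Lagrange interpolation product. Since \<open>h\<close>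
  and the constants keep \<open>T\<close> stable, so does this polynomial.\<close>

lemma ind_in_stabiliser:
  assumes X: "finite X" and T: "sub X T" and h: "\<And>t. t \<in> T \<Longrightarrow> h * t \<in> T"
    and i: "i \<in> X" and C: "C = {k \<in> X. h k - h i \<in> I}" and t: "t \<in> T"
  shows "ind C * t \<in> T"
proof -
  have "\<forall>k\<in>X - C. \<exists>c. (h i - h k) * c - 1 \<in> I"
  proof
    fix k assume "k \<in> X - C"
    then have "h i - h k \<notin> I" using uminus_I[of "h i - h k"] unfolding C by auto
    then show "\<exists>c. (h i - h k) * c - 1 \<in> I" by (rule inv_I)
  qed
  then obtain c where c: "\<And>k. k \<in> X - C \<Longrightarrow> (h i - h k) * c k - 1 \<in> I" by metis
  \<comment> \<open>\<open>c k\<close> inverts \<open>h i - h k\<close> modulo \<open>I\<close>, so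
    the product is 1 on \<open>C\<close>; at \<open>j\<close> in \<open>X - C\<close> its factor
    with \<open>k = j\<close> vanishes.\<close>
  define e where "e A = (\<lambda>j. \<Prod>k\<in>A. (h j - h k) * c k)" for A
  have "e A * t \<in> T" if "finite A" for A
    using that
  proof (induction A rule: finite_induct)
    case empty
    have "e {} * t = t" by (simp add: e_def fun_eq_iff)
    then show ?case using t by simp
  next
    case (insert k A)
    have "e (insert k A) * t = (\<lambda>_. c k) * (h * (e A * t) - (\<lambda>_. h k) * (e A * t))"
      using insert by (simp add: e_def fun_eq_iff algebra_simps)
    also have "\<dots> \<in> T"
      by (intro lin_scale lin_diff sub_lin[OF T] h insert.IH)
    finally show ?case .
  qed
  then have "e (X - C) * t \<in> T" using X by simp
  moreover have "eqv X (ind C) (e (X - C))"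
    unfolding eqv_def
  proof
    fix j assume j: "j \<in> X"
    show "ind C j - e (X - C) j \<in> I"
    proof (cases "j \<in> C")
      case True
      have "e A j - 1 \<in> I" if "finite A" "A \<subseteq> X - C" for A
        using that
      proof (induction A rule: finite_induct)
        case empty
        then show ?case by (simp add: e_def zero_I)
      next
        case (insert k A)
        have 1: "(h i - h k) * c k - 1 \<in> I" using c insert.prems by blast
        have 2: "h j - h i \<in> I" using True C by blast
        have "e (insert k A) j - 1 = (h j - h k) * c k * (e A j - 1)
            + ((h i - h k) * c k - 1) + c k * (h j - h i)"
          using insert by (simp add: e_def algebra_simps)
        also have "\<dots> \<in> I" using 1 2 insert by (intro add_I mult_I) auto
        finally show ?case .
      qed
      then have "e (X - C) j - 1 \<in> I" using X by simp
      then have "- (e (X - C) j - 1) \<in> I" by (rule uminus_I)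
      then show ?thesis using True by (simp add: ind_def)
    next
      case False
      then have "e (X - C) j = 0"
        using X j unfolding e_def by (intro prod_zero bexI[of _ j]) auto
      then show ?thesis using False by (simp add: ind_def zero_I)
    qed
  qed
  ultimately show ?thesis using sub_eqv[OF T] eqv_mult2 by blast
qed

text \<open>Dividing \<open>S\<close> by the unit \<open>s\<close> and multiplying \<open>T\<close> by it makes the transform applicable. It ends
  with a space stable under a subspace \<open>S'\<close>: either \<open>S'\<close> consists of constants, or the level sets of
  a nonconstant element provide the block \<open>C\<close>.\<close>

lemma unit_dichotomy:
  assumes X: "finite X" and P: "sub X P" and S: "sub X S" and T: "sub X T"
    and ST: "\<And>s t. s \<in> S \<Longrightarrow> t \<in> T \<Longrightarrow> s * t \<in> P"
    and s: "s \<in> S" and unit: "\<And>i. i \<in> X \<Longrightarrow> s i \<notin> I"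
  shows "sz X S * sz X T \<le> q * sz X P \<or>
    (\<exists>C\<subset>X. C \<noteq> {} \<and> (\<forall>t\<in>T. ind C * (s * t) \<in> P))"
proof -
  have "\<forall>i\<in>X. \<exists>y. s i * y - 1 \<in> I" using inv_I unit by blast
  then obtain s' where s': "\<And>i. i \<in> X \<Longrightarrow> s i * s' i - 1 \<in> I" by metis
  have inv: "eqv X (s * s' * f) f" for f
  proof -
    have "s i * s' i * f i - f i = f i * (s i * s' i - 1)" for i by (simp add: algebra_simps)
    then show ?thesis unfolding eqv_def using s' mult_I by simp
  qed
  \<comment> \<open>These are s^(-1) S and s T, written as preimages; \<open>s'\<close> is the
    inverse of \<open>s\<close> on \<open>X\<close>.\<close>
  let ?S = "{f. s * f \<in> S}" and ?T = "{f. s' * f \<in> T}"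
  have szS: "sz X S \<le> sz X ?S"
  proof (rule sz_inj_le[where \<phi> = "\<lambda>f. s' * f", OF X])
    fix f assume "f \<in> S"
    then have "s * s' * f \<in> S" using sub_eqv[OF S] inv by blast
    then show "s' * f \<in> ?S" by (simp add: mult.assoc)
  next
    fix f g assume "eqv X (s' * f) (s' * g)"
    then have "eqv X (s * (s' * f)) (s * (s' * g))" by (rule eqv_mult)
    then show "eqv X f g" using inv by (metis eqv_sym eqv_trans mult.assoc)
  qed
  have szT: "sz X T \<le> sz X ?T"
  proof (rule sz_inj_le[where \<phi> = "\<lambda>f. s * f", OF X])
    fix f assume "f \<in> T"
    then have "s * s' * f \<in> T" using sub_eqv[OF T] inv by blast
    then show "s * f \<in> ?T" by (simp add: algebra_simps)
  next
    fix f g assume "eqv X (s * f) (s * g)"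
    then have "eqv X (s' * (s * f)) (s' * (s * g))" by (rule eqv_mult)
    then show "eqv X f g" using inv by (metis eqv_sym eqv_trans mult.assoc mult.commute)
  qed
  have "f * g \<in> P" if "f \<in> ?S" "g \<in> ?T" for f g
  proof -
    have "(s * f) * (s' * g) \<in> P" using that ST by blast
    then have "s * s' * (f * g) \<in> P" by (simp add: algebra_simps)
    then show ?thesis using sub_eqv[OF P] inv eqv_sym by blast
  qed
  moreover have "1 \<in> ?S" using s by simp
  ultimately obtain S' T' where T': "sub X T'" and one: "1 \<in> S'" and TT': "?T \<subseteq> T'" and T'P: "T' \<subseteq> P"
    and stab: "\<forall>s\<in>S'. \<forall>t\<in>T'. s * t \<in> T'" and le: "sz X ?S * sz X ?T \<le> sz X S' * sz X T'"
    using transform_exhaust[OF X P sub_preimage[OF S] sub_preimage[OF T]] by blast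
  have le': "sz X S * sz X T \<le> sz X S' * sz X P"
    using order_trans[OF mult_le_mono[OF szS szT] le] mult_le_mono2[OF sz_mono[OF X T'P]]
    by (rule order_trans)
  show ?thesis
  proof (cases "\<forall>h\<in>S'. \<forall>i\<in>X. \<forall>j\<in>X. h i - h j \<in> I")
    case True
    \<comment> \<open>Elements of \<open>S'\<close> are constant on \<open>X\<close> modulo
      \<open>I\<close>, hence determined by one coordinate.\<close>
    have "sz X S' \<le> q"
    proof (cases "X = {}")
      case True
      then show ?thesis using sz_empty[of S'] one q_ge2 by (cases "S' = {}") auto
    next
      case False
      then obtain i where i: "i \<in> X" by blast
      have "sz X S' \<le> sz {i} UNIV"
      proof (rule sz_inj_le[where \<phi> = id])
        fix f g assume f: "f \<in> S'" and g: "g \<in> S'" and "eqv {i} (id f) (id g)"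
        then have fg: "f i - g i \<in> I" by (simp add: eqv_def)
        have "f j - g j \<in> I" if j: "j \<in> X" for j
        proof -
          have "f j - f i \<in> I" "g j - g i \<in> I" using True f g i j by blast+
          then have "(f j - f i) - (g j - g i) + (f i - g i) \<in> I" using fg by (metis add_I diff_I)
          then show ?thesis by (simp add: algebra_simps)
        qed
        then show "eqv X f g" by (simp add: eqv_def)
      qed auto
      then show ?thesis by (simp add: sz_UNIV)
    qed
    then have "sz X S' * sz X P \<le> q * sz X P" by (rule mult_le_mono1)
    then show ?thesis using order_trans[OF le'] by blast
  next
    case False
    then obtain h i j where h: "h \<in> S'" and ij: "i \<in> X" "j \<in> X" and "h i - h j \<notin> I" by blast
    then have hji: "h j - h i \<notin> I" using uminus_I[of "h j - h i"] by auto
    define C where "C = {k \<in> X. h k - h i \<in> I}"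
    have "i \<in> C" "j \<notin> C" using ij hji by (auto simp: C_def zero_I)
    then have "C \<subset> X" "C \<noteq> {}" using ij unfolding C_def by auto
    moreover have "ind C * (s * t) \<in> P" if t: "t \<in> T" for t
    proof -
      have "s * s' * t \<in> T" using t sub_eqv[OF T] inv by blast
      then have "s * t \<in> ?T" by (simp add: algebra_simps)
      then have "ind C * (s * t) \<in> T'"
        using ind_in_stabiliser[OF X T' _ ij(1) C_def] stab h TT' by blast
      then show ?thesis using T'P by blast
    qed
    ultimately show ?thesis by blast
  qed
qed

text \<open>All sizes are powers of \<open>q\<close>, so a proper subspace has at most a share 1/q
  of the classes of \<open>S\<close>, and fewer than \<open>q\<close> of them cannot cover
  it.\<close>

lemma sub_union_cover:
  assumes X: "finite X" and S: "sub X S" and fin: "finite \<M>"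
    and M: "\<And>M. M \<in> \<M> \<Longrightarrow> sub X M \<and> M \<subseteq> S"
    and cover: "S \<subseteq> \<Union>\<M>" and card: "card \<M> < q"
  shows "S \<in> \<M>"
proof (rule ccontr)
  assume nS: "S \<notin> \<M>"
  have small: "q * sz X M \<le> sz X S" if MM: "M \<in> \<M>" for M
  proof -
    have "M \<subseteq> S" "M \<noteq> S" using M[OF MM] nS MM by auto
    then obtain f where f: "f \<in> S" "f \<notin> M" by blast
    have lt: "sz X M < sz X S" using sz_psubset[OF X _ _ f] M[OF MM] by blast
    have "lin M" using M[OF MM] sub_lin by blast
    then obtain d where d: "sz X M = q ^ d" using sz_power_boolean[OF X] by blast
    obtain d' where d': "sz X S = q ^ d'" using sz_power_boolean[OF X sub_lin[OF S]] by blast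
    have "d < d'" using lt q_ge2 unfolding d d' by (simp add: power_strict_increasing_iff)
    then have "q ^ Suc d \<le> q ^ d'" using q_ge2 by (intro power_increasing) auto
    then show ?thesis by (simp add: d d')
  qed
  have "sz X S \<le> card (\<Union>M\<in>\<M>. nrm X ` M)"
    unfolding sz_def using cover fin by (intro card_mono finite_UN_I finite_nrm X) auto
  also have "\<dots> \<le> (\<Sum>M\<in>\<M>. sz X M)"
    unfolding sz_def using fin by (rule card_UN_le)
  finally have "q * sz X S \<le> q * (\<Sum>M\<in>\<M>. sz X M)" by simp
  also have "\<dots> = (\<Sum>M\<in>\<M>. q * sz X M)" by (rule sum_distrib_left)
  also have "\<dots> \<le> (\<Sum>M\<in>\<M>. sz X S)" by (rule sum_mono) (rule small)
  finally have "q * sz X S \<le> card \<M> * sz X S" by simp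
  moreover have "sz X S > 0" using sz_pos[OF X lin_zero[OF sub_lin[OF S]]] .
  ultimately show False using card by simp
qed

text \<open>The block found for a unit \<open>s\<close> may depend on that unit, but a space over a
  large field is not a union of few proper subspaces, so one block serves all of \<open>S\<close>.\<close>

lemma kneser_dichotomy:
  assumes X: "finite X" and P: "sub X P" and S: "sub X S" and T: "sub X T"
    and ST: "\<And>s t. s \<in> S \<Longrightarrow> t \<in> T \<Longrightarrow> s * t \<in> P"
    and one: "1 \<in> S" and large: "2 ^ card X + card X < q"
  shows "sz X S * sz X T \<le> q * sz X P \<or>
    (\<exists>C\<subset>X. C \<noteq> {} \<and> (\<forall>s\<in>S. \<forall>t\<in>T. ind C * (s * t) \<in> P))"
proof (cases "sz X S * sz X T \<le> q * sz X P")
  case False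
  \<comment> \<open>\<open>Z C\<close> collects the \<open>s\<close> for which the block
    \<open>C\<close> works, \<open>N i\<close> the non-units vanishing at \<open>i\<close>. When the
    size bound fails, \<open>unit_dichotomy\<close> makes these spaces cover
    \<open>S\<close>.\<close>
  define Z where "Z C = {s \<in> S. \<forall>t\<in>T. ind C * (s * t) \<in> P}" for C
  define N where "N i = {s \<in> S. s i \<in> I}" for i
  define \<C> where "\<C> = {C. C \<subset> X \<and> C \<noteq> {}}"
  have fin: "finite \<C>" unfolding \<C>_def by (rule finite_subset[of _ "Pow X"]) (use X in auto)
  have Z: "sub X (Z C)" for C
    unfolding sub_def lin_def
  proof (intro conjI ballI allI impI)
    show "0 \<in> Z C" using S P by (simp add: Z_def lin_zero sub_lin)
  next
    fix f g assume "f \<in> Z C" "g \<in> Z C"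
    then show "f + g \<in> Z C"
      using S P by (simp add: Z_def distrib_left distrib_right lin_add sub_lin)
  next
    fix c f assume f: "f \<in> Z C"
    have "ind C * ((\<lambda>_. c) * f * t) \<in> P" if "t \<in> T" for t
    proof -
      have "(\<lambda>_. c) * (ind C * (f * t)) \<in> P"
        using f that by (intro lin_scale[OF sub_lin[OF P]]) (simp add: Z_def)
      moreover have "ind C * ((\<lambda>_. c) * f * t) = (\<lambda>_. c) * (ind C * (f * t))"
        by (simp only: ac_simps)
      ultimately show ?thesis by metis
    qed
    then show "(\<lambda>_. c) * f \<in> Z C"
      using f S by (simp add: Z_def lin_scale sub_lin)
  next
    fix f g assume f: "f \<in> Z C" and e: "eqv X g f"
    have "g \<in> S" using f e sub_eqv[OF S] by (auto simp: Z_def)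
    moreover have "ind C * (g * t) \<in> P" if "t \<in> T" for t
    proof (rule sub_eqv[OF P])
      show "ind C * (f * t) \<in> P" using f that by (simp add: Z_def)
      show "eqv X (ind C * (g * t)) (ind C * (f * t))" by (intro eqv_mult eqv_mult2 e)
    qed
    ultimately show "g \<in> Z C" by (simp add: Z_def)
  qed
  have N: "sub X (N i)" if "i \<in> X" for i
    unfolding sub_def
  proof (intro conjI ballI allI impI)
    show "lin (N i)" unfolding N_def by (rule lin_pivot_kernel[OF sub_lin[OF S]])
  next
    fix f g assume f: "f \<in> N i" and e: "eqv X g f"
    have "g i - f i \<in> I" using e that by (simp add: eqv_def)
    moreover have "f i \<in> I" using f by (simp add: N_def)
    ultimately have "(g i - f i) + f i \<in> I" by (rule add_I)
    then show "g \<in> N i" using f e sub_eqv[OF S] by (auto simp: N_def)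
  qed
  have "S \<in> Z ` \<C> \<union> N ` X"
  proof (rule sub_union_cover[OF X S])
    show "finite (Z ` \<C> \<union> N ` X)" using fin X by simp
    show "sub X M \<and> M \<subseteq> S" if "M \<in> Z ` \<C> \<union> N ` X" for M
      using that Z N unfolding Z_def N_def by blast
    show "S \<subseteq> \<Union> (Z ` \<C> \<union> N ` X)"
    proof
      fix s assume s: "s \<in> S"
      show "s \<in> \<Union> (Z ` \<C> \<union> N ` X)"
      proof (cases "\<exists>i\<in>X. s i \<in> I")
        case True
        then show ?thesis using s by (auto simp: N_def)
      next
        case no: False
        then obtain C where "C \<subset> X" "C \<noteq> {}" "\<forall>t\<in>T. ind C * (s * t) \<in> P"
          using unit_dichotomy[OF X P S T ST s] False by blast
        then have "C \<in> \<C>" "s \<in> Z C" using s by (auto simp: \<C>_def Z_def)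
        then show ?thesis by blast
      qed
    qed
    have "card (Z ` \<C> \<union> N ` X) \<le> card (Z ` \<C>) + card (N ` X)" by (rule card_Un_le)
    also have "\<dots> \<le> card \<C> + card X" by (intro add_mono card_image_le fin X)
    also have "card \<C> \<le> card (Pow X)" unfolding \<C>_def by (rule card_mono) (use X in auto)
    finally show "card (Z ` \<C> \<union> N ` X) < q" using large X by (simp add: card_Pow)
  qed
  \<comment> \<open>The constant 1 rules out the spaces \<open>N i\<close>, so \<open>S\<close>
    equals some \<open>Z C\<close>.\<close>
  moreover have "1 \<notin> N i" for i using one_I by (simp add: N_def)
  ultimately obtain C where "C \<in> \<C>" "S = Z C" using one by blast
  then show ?thesis unfolding \<C>_def Z_def by blast
qed simp

section \<open>Codes whose p-fold products sum to zero\<close>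

definition spn :: "('i \<Rightarrow> 'a) set \<Rightarrow> ('i \<Rightarrow> 'a) set" where
  "spn \<Gamma> = \<Inter>{M. lin M \<and> \<Gamma> \<subseteq> M}"

lemma lin_spn: "lin (spn \<Gamma>)"
  unfolding spn_def lin_def by blast

lemma spn_superset: "\<Gamma> \<subseteq> spn \<Gamma>"
  unfolding spn_def by blast

lemma spn_minimal: "lin M \<Longrightarrow> \<Gamma> \<subseteq> M \<Longrightarrow> spn \<Gamma> \<subseteq> M"
  unfolding spn_def by blast

text \<open>These are the Schur powers of \<open>V\<close>: the \<open>j\<close>-th one is spanned
  by the coordinatewise products of \<open>j\<close> elements.\<close>

fun pw :: "('i \<Rightarrow> 'a) set \<Rightarrow> nat \<Rightarrow> ('i \<Rightarrow> 'a) set" where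
  "pw V 0 = spn {1}"
| "pw V (Suc j) = spn {v * f |v f. v \<in> V \<and> f \<in> pw V j}"

lemma lin_pw: "lin (pw V j)"
  by (cases j) (simp_all add: lin_spn)

lemma mult_pw: "v \<in> V \<Longrightarrow> f \<in> pw V j \<Longrightarrow> v * f \<in> pw V (Suc j)"
  using spn_superset by fastforce

lemma one_pw: "1 \<in> V \<Longrightarrow> 1 \<in> pw V j"
proof (induction j)
  case 0
  show ?case unfolding pw.simps using spn_superset by blast
next
  case (Suc j)
  then show ?case using mult_pw[of 1 V 1 j] by (metis mult_1_right)
qed

lemma sz_pw_0: "finite X \<Longrightarrow> X \<noteq> {} \<Longrightarrow> q \<le> sz X (pw V 0)"
proof -
  assume X: "finite X" "X \<noteq> {}"
  then obtain i where i: "i \<in> X" by blast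
  have "sz {i} UNIV \<le> sz X (pw V 0)"
  proof (rule sz_inj_le[where \<phi> = "\<lambda>f _. f i", OF X(1)])
    fix f :: "'b \<Rightarrow> 'a"
    have "1 \<in> pw V 0" unfolding pw.simps using spn_superset by blast
    then have "(\<lambda>_. f i) * 1 \<in> pw V 0" by (rule lin_scale[OF lin_pw])
    then show "(\<lambda>_. f i) \<in> pw V 0" unfolding mult_1_right .
  qed (use i in \<open>auto simp: eqv_def\<close>)
  then show ?thesis by (simp add: sz_UNIV)
qed

text \<open>Multiplication by \<open>ind C\<close> commutes with multiplication by further elements
  of \<open>V\<close>, so stability of one power is inherited by all later ones.\<close>

lemma ind_mult_pw_cl:
  assumes "\<And>f. f \<in> pw V j \<Longrightarrow> ind C * f \<in> cl X (pw V j)"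
    and "j \<le> k" "f \<in> pw V k"
  shows "ind C * f \<in> cl X (pw V k)"
  using assms(2,3)
proof (induction k arbitrary: f rule: dec_induct)
  case base
  then show ?case using assms(1) by blast
next
  case (step k)
  let ?M = "{f. ind C * f \<in> cl X (pw V (Suc k))}"
  have "lin ?M" by (intro sub_lin[OF sub_preimage[OF sub_cl[OF lin_pw]]])
  moreover have "{v * f |v f. v \<in> V \<and> f \<in> pw V k} \<subseteq> ?M"
  proof clarify
    fix v g assume v: "v \<in> V" and g: "g \<in> pw V k"
    obtain m where m: "m \<in> pw V k" "eqv X (ind C * g) m"
      using step.IH[OF g] unfolding cl_def by blast
    have "eqv X (v * (ind C * g)) (v * m)" by (rule eqv_mult[OF m(2)])
    moreover have "v * (ind C * g) = ind C * (v * g)" by (rule mult.left_commute)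
    ultimately show "ind C * (v * g) \<in> cl X (pw V (Suc k))"
      unfolding cl_def using mult_pw[OF v m(1)] by auto
  qed
  ultimately have "pw V (Suc k) \<subseteq> ?M" unfolding pw.simps(2) by (rule spn_minimal)
  then show ?case using step.prems by blast
qed

text \<open>By Bezout, a number prime to \<open>p\<close> is invertible modulo \<open>p\<close>, so
  its image in \<open>I\<close> would put 1 into \<open>I\<close>.\<close>

lemma of_nat_in_I_iff:
  assumes "prime p" "of_nat p \<in> I"
  shows "of_nat m \<in> I \<longleftrightarrow> p dvd m"
proof
  assume "p dvd m"
  then show "of_nat m \<in> I" using mult_I2[OF assms(2)] by (auto elim!: dvdE)
next
  assume m: "of_nat m \<in> I"
  show "p dvd m"
  proof (rule ccontr)
    assume n: "\<not> p dvd m"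
    then have "coprime m p" using assms(1) prime_imp_coprime coprime_commute by blast
    moreover have "m \<noteq> 0" using n by (rule contrapos_nn) simp
    ultimately obtain x y where "m * x = p * y + 1"
      using bezout_nat[of m p] by auto
    then have "(of_nat (m * x) :: 'a) = of_nat (p * y + 1)" by simp
    then have "1 = of_nat m * of_nat x - of_nat p * (of_nat y :: 'a)" by (simp add: algebra_simps)
    also have "\<dots> \<in> I" by (intro diff_I mult_I2 m assms)
    finally show False using one_I by simp
  qed
qed

lemma sum_eqv:
  assumes "eqv X f g" shows "(\<Sum>i\<in>X. f i) - (\<Sum>i\<in>X. g i) \<in> I"
  unfolding sum_subtractf[symmetric] using assms by (intro sum_I) (simp add: eqv_def)

text \<open>If no proper nonempty block can be split off, then Kneser's inequality
  gives \<open>p dim V \<le> |X| + p - 2\<close>, and the defect \<open>p - 2\<close> disappears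
  because \<open>1 \<in> V\<close> forces \<open>p\<close> to divide \<open>|X|\<close>.\<close>

lemma sz_power_le:
  assumes p: "prime p" "of_nat p \<in> I" and V: "lin V" "1 \<in> V"
    and "finite X" "2 ^ card X + card X < q" "\<And>f. f \<in> pw V p \<Longrightarrow> (\<Sum>i\<in>X. f i) \<in> I"
  shows "sz X V ^ p \<le> q ^ card X"
  using assms(5-)
proof (induction "card X" arbitrary: X rule: less_induct)
  case less
  note X = less.prems(1)
  have p2: "2 \<le> p" using p prime_ge_2_nat by blast
  \<comment> \<open>In the second case the vanishing of sums passes to \<open>C\<close> and to its
    complement, and the two bounds multiply. In the third case no block splits off.\<close>
  consider "X = {}" | C where "C \<subset> X" "C \<noteq> {}" "\<And>f. f \<in> pw V p \<Longrightarrow> (\<Sum>i\<in>C. f i) \<in> I"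
    | "X \<noteq> {}" "\<And>C. C \<subset> X \<Longrightarrow> C \<noteq> {} \<Longrightarrow> \<exists>f\<in>pw V p. (\<Sum>i\<in>C. f i) \<notin> I"
    by metis
  then show ?case
  proof cases
    case 1
    then show ?thesis using sz_empty[of V] V by (cases "V = {}") auto
  next
    case (2 C)
    have CX: "C \<subseteq> X" using 2 by blast
    have fC: "finite C" using finite_subset[OF CX X] .
    have cards: "card C < card X" "card (X - C) < card X"
      using X 2 CX fC by (auto intro!: psubset_card_mono)
    have large: "2 ^ card A + card A < q" if "A \<subseteq> X" for A
    proof -
      have "card A \<le> card X" using card_mono[OF X that] .
      moreover from this have "(2::nat) ^ card A \<le> 2 ^ card X" by (rule power_increasing) simp
      ultimately show ?thesis using less.prems(2) by linarith
    qed
    have "(\<Sum>i\<in>X - C. f i) \<in> I" if "f \<in> pw V p" for f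
      using sum_diff[OF X CX, of f] diff_I[OF less.prems(3)[OF that] 2(3)[OF that]] by simp
    then have "sz (X - C) V ^ p \<le> q ^ card (X - C)"
      using less.hyps[OF cards(2)] X large by blast
    moreover have "sz C V ^ p \<le> q ^ card C"
      using less.hyps[OF cards(1) fC] large CX 2(3) by blast
    ultimately have "(sz C V * sz (X - C) V) ^ p \<le> q ^ card C * q ^ card (X - C)"
      by (simp add: power_mult_distrib mult_le_mono)
    also have "\<dots> = q ^ card X"
      using card_mono[OF X CX] by (simp add: power_add[symmetric] card_Diff_subset[OF fC CX])
    finally have "(sz C V * sz (X - C) V) ^ p \<le> q ^ card X" .
    moreover have "sz X V \<le> sz C V * sz (X - C) V"
      using sz_Un_le[OF fC, of "X - C" V] X CX by (simp add: Un_absorb1)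
    ultimately show ?thesis using power_mono[of "sz X V" _ p] order_trans by blast
  next
    case 3
    \<comment> \<open>A block from \<open>kneser_dichotomy\<close> would stabilise
      \<open>pw V (Suc j)\<close>, hence also \<open>pw V p\<close> as \<open>Suc j \<le> p\<close>,
      and then the sums over that block would vanish.\<close>
    have step: "sz X V * sz X (pw V j) \<le> q * sz X (pw V (Suc j))" if j: "Suc j \<le> p" for j
    proof (rule ccontr)
      assume "\<not> ?thesis"
      moreover have "s * t \<in> cl X (pw V (Suc j))" if st: "s \<in> cl X V" "t \<in> cl X (pw V j)" for s t
      proof -
        obtain s' t' where *: "s' \<in> V" "eqv X s s'" "t' \<in> pw V j" "eqv X t t'"
          using st by (auto simp: cl_def)
        have "eqv X (s * t) (s' * t')"
          using eqv_trans[OF eqv_mult2[OF *(2)] eqv_mult[OF *(4)]] .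
        then show ?thesis unfolding cl_def using mult_pw[OF *(1,3)] by blast
      qed
      moreover have "1 \<in> cl X V" using V cl_superset by blast
      ultimately obtain C where C: "C \<subset> X" "C \<noteq> {}"
        and CP: "\<And>s t. s \<in> cl X V \<Longrightarrow> t \<in> cl X (pw V j) \<Longrightarrow> ind C * (s * t) \<in> cl X (pw V (Suc j))"
        using kneser_dichotomy[OF X sub_cl[OF lin_pw[of V "Suc j"]] sub_cl[OF V(1)]
            sub_cl[OF lin_pw[of V j]] _ _ less.prems(2)] unfolding sz_cl by blast
      have "pw V (Suc j) \<subseteq> {f. ind C * f \<in> cl X (pw V (Suc j))}"
        unfolding pw.simps(2)[of V j]
      proof (rule spn_minimal)
        show "lin {f. ind C * f \<in> cl X (spn {v * f |v f. v \<in> V \<and> f \<in> pw V j})}"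
          by (rule sub_lin[OF sub_preimage[OF sub_cl[OF lin_spn]]])
        show "{v * f |v f. v \<in> V \<and> f \<in> pw V j}
            \<subseteq> {f. ind C * f \<in> cl X (spn {v * f |v f. v \<in> V \<and> f \<in> pw V j})}"
          using CP cl_superset unfolding pw.simps(2) by blast
      qed
      then have "ind C * f \<in> cl X (pw V p)" if "f \<in> pw V p" for f
        using ind_mult_pw_cl[OF _ j that] by blast
      then have "(\<Sum>i\<in>C. f i) \<in> I" if f: "f \<in> pw V p" for f
      proof -
        obtain m where m: "m \<in> pw V p" "eqv X (ind C * f) m"
          using \<open>\<And>f. f \<in> pw V p \<Longrightarrow> ind C * f \<in> cl X (pw V p)\<close>[OF f] unfolding cl_def by blast
        have "(\<Sum>i\<in>X. (ind C * f) i) - (\<Sum>i\<in>X. m i) + (\<Sum>i\<in>X. m i) \<in> I"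
          by (intro add_I sum_eqv m(2) less.prems(3) m(1))
        moreover have "(\<Sum>i\<in>X. (ind C * f) i) = (\<Sum>i\<in>C. f i)"
          using X C by (intro sum.mono_neutral_cong_right) (auto simp: ind_def)
        ultimately show ?thesis by simp
      qed
      then show False using 3(2)[OF C] by blast
    qed
    \<comment> \<open>In dimensions, the \<open>j\<close>-th power has dimension at least j dim V -
      (j - 1), starting from the constants at \<open>j = 0\<close>.\<close>
    have growth: "sz X V ^ j * q \<le> q ^ j * sz X (pw V j)" if "j \<le> p" for j
      using that
    proof (induction j)
      case 0
      show ?case using sz_pw_0[OF X 3(1), of V] by simp
    next
      case (Suc j)
      have "sz X V ^ Suc j * q \<le> sz X V * (q ^ j * sz X (pw V j))"
        using Suc by (simp add: mult.assoc)
      also have "\<dots> = q ^ j * (sz X V * sz X (pw V j))" by simp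
      also have "\<dots> \<le> q ^ j * (q * sz X (pw V (Suc j)))"
        by (intro mult_le_mono2 step Suc.prems)
      finally show ?case by (simp add: ac_simps)
    qed
    obtain k where k: "p = Suc k" using p2 by (cases p) auto
    have orth: "sz X V * sz X (pw V k) \<le> q ^ card X"
    proof (rule sz_orthogonal[OF X V(1) lin_pw])
      fix f g assume "f \<in> V" "g \<in> pw V k"
      then have "f * g \<in> pw V p" unfolding k by (rule mult_pw)
      then show "(\<Sum>i\<in>X. f i * g i) \<in> I" using less.prems(3) by fastforce
    qed
    have "sz X V ^ p * q = sz X V * (sz X V ^ k * q)" by (simp add: k)
    also have "\<dots> \<le> sz X V * (q ^ k * sz X (pw V k))"
      using growth[of k] k by (intro mult_le_mono2) simp
    also have "\<dots> = q ^ k * (sz X V * sz X (pw V k))" by simp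
    also have "\<dots> \<le> q ^ k * q ^ card X" by (intro mult_le_mono2 orth)
    finally have main: "sz X V ^ p * q \<le> q ^ (k + card X)" by (simp add: power_add)
    \<comment> \<open>The constant 1 lies in \<open>pw V p\<close>, and its coordinates sum to the
      image of \<open>card X\<close>.\<close>
    have "(\<Sum>i\<in>X. (1 :: 'b \<Rightarrow> 'a) i) \<in> I" using less.prems(3) one_pw[OF V(2)] by blast
    then have "p dvd card X" using of_nat_in_I_iff[OF p] by simp
    then obtain m where m: "card X = p * m" by blast
    obtain d where d: "sz X V = q ^ d" using sz_power_boolean[OF X V(1)] by blast
    have "q ^ (d * p + 1) \<le> q ^ (k + card X)" using main unfolding d by (simp only: power_add power_mult power_one_right)
    then have "d * p + 1 \<le> k + p * m" using q_ge2 unfolding m by (subst (asm) power_increasing_iff) simp_all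
    \<comment> \<open>As \<open>k\<close> is p - 1, \<open>d * p\<close> is at most p m + p - 2,
      which is below the next multiple of \<open>p\<close>.\<close>
    then have "d * p < Suc m * p" unfolding k by (simp add: algebra_simps)
    then have "d \<le> m" using mult_less_cancel2 less_Suc_eq_le by metis
    then have "q ^ (d * p) \<le> q ^ card X" unfolding m using q_ge2 by (intro power_increasing) simp_all
    then show ?thesis by (simp add: d power_mult)
  qed
qed

text \<open>Products of indicators are indicators of intersections, so divisibility of the
  intersections makes the coordinate sums on \<open>pw V p\<close> vanish. \<open>V\<close> itself
  is part of the conclusion because the padding argument also counts complements, which enter
  through \<open>1 - ind A\<close>.\<close>

lemma boolean_family_bound:
  assumes p: "prime p" "of_nat p \<in> I" and X: "finite X" and large: "2 ^ card X + card X < q"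
    and dv: "p dvd card X" and G: "\<And>A. A \<in> G \<Longrightarrow> A \<subseteq> X"
    and div: "\<And>j A. 1 \<le> j \<Longrightarrow> j \<le> p \<Longrightarrow> (\<And>i. i \<in> {1..j} \<Longrightarrow> A i \<in> G) \<Longrightarrow>
      p dvd card (\<Inter>i\<in>{1..j}. A i)"
  shows "\<exists>V. lin V \<and> 1 \<in> V \<and> (\<forall>A\<in>G. ind A \<in> V) \<and> card (boolean_in X V 0) \<le> 2 ^ (card X div p)"
proof -
  define V where "V = spn (insert 1 (ind ` G))"
  have "insert 1 (ind ` G) \<subseteq> V" unfolding V_def by (rule spn_superset)
  then have V: "1 \<in> V" "\<And>A. A \<in> G \<Longrightarrow> ind A \<in> V" by blast+
  have linV: "lin V" unfolding V_def by (rule lin_spn)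
  \<comment> \<open>\<open>X\<close> stands for the empty intersection: its indicator is 1 on
    \<open>X\<close>, so \<open>\<B> 0\<close> matches the zeroth power.\<close>
  define \<B> where "\<B> j = insert X {(\<Inter>i\<in>{1..k}. A i) |k A. 1 \<le> k \<and> k \<le> j \<and> (\<forall>i\<in>{1..k}. A i \<in> G)}"
    for j :: nat
  have \<B>I: "(\<Inter>i\<in>{1..k}. A i) \<in> \<B> j" if "1 \<le> k" "k \<le> j" "\<forall>i\<in>{1..k}. A i \<in> G" for k j A
    unfolding \<B>_def using that by blast
  have \<B>E: "B = X \<or> (\<exists>k A. 1 \<le> k \<and> k \<le> j \<and> (\<forall>i\<in>{1..k}. A i \<in> G) \<and> B = (\<Inter>i\<in>{1..k}. A i))"
    if "B \<in> \<B> j" for B j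
    using that unfolding \<B>_def by blast
  have \<B>G: "A \<inter> B \<in> \<B> (Suc j)" if A: "A \<in> G" and B: "B \<in> \<B> j" for A B j
  proof (cases "B = X")
    case True
    have "A \<inter> B = (\<Inter>i\<in>{1..1::nat}. (\<lambda>_. A) i)" using True G[OF A] by auto
    moreover have "\<dots> \<in> \<B> (Suc j)" using A by (intro \<B>I) auto
    ultimately show ?thesis by simp
  next
    case False
    then obtain k A' where k: "1 \<le> k" "k \<le> j" "\<forall>i\<in>{1..k}. A' i \<in> G" "B = (\<Inter>i\<in>{1..k}. A' i)"
      using \<B>E[OF B] by blast
    define A'' where "A'' = A'(Suc k := A)"
    have "\<forall>i\<in>{1..Suc k}. A'' i \<in> G" using k A by (auto simp: A''_def)
    then have "(\<Inter>i\<in>{1..Suc k}. A'' i) \<in> \<B> (Suc j)" using k by (intro \<B>I) simp_all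
    moreover have "A \<inter> B = (\<Inter>i\<in>{1..Suc k}. A'' i)"
    proof -
      have "{1..Suc k} = insert (Suc k) {1..k}" by auto
      then show ?thesis by (auto simp: A''_def k(4))
    qed
    ultimately show ?thesis by simp
  qed
  have mono: "\<B> j \<subseteq> \<B> (Suc j)" for j
    unfolding \<B>_def by (intro insert_mono Collect_mono) (blast intro: le_SucI)
  have \<B>X: "B \<subseteq> X" if "B \<in> \<B> j" for B j
    using \<B>E[OF that]
  proof
    assume "\<exists>k A. 1 \<le> k \<and> k \<le> j \<and> (\<forall>i\<in>{1..k}. A i \<in> G) \<and> B = (\<Inter>i\<in>{1..k}. A i)"
    then obtain k :: nat and A where k: "1 \<le> k" "\<forall>i\<in>{1..k}. A i \<in> G" "B = (\<Inter>i\<in>{1..k}. A i)" by blast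
    then have "1 \<in> {1..k}" by simp
    then show ?thesis using k G by blast
  qed simp
  have pwB: "pw V j \<subseteq> cl X (spn (ind ` \<B> j))" for j
  proof (induction j)
    case 0
    have "eqv X 1 (ind X)" by (simp add: eqv_def ind_def zero_I)
    then have "1 \<in> cl X (spn (ind ` \<B> 0))"
      unfolding cl_def using spn_superset by (force simp: \<B>_def)
    then show ?case unfolding pw.simps
      by (intro spn_minimal sub_lin[OF sub_cl[OF lin_spn]]) simp_all
  next
    case (Suc j)
    let ?P = "cl X (spn (ind ` \<B> (Suc j)))"
    have P: "sub X ?P" by (rule sub_cl[OF lin_spn])
    have gen: "ind B \<in> ?P" if "B \<in> \<B> (Suc j)" for B
      using that spn_superset cl_superset by blast
    have ker: "lin {f. v * f \<in> ?P}" for v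
      by (rule sub_lin[OF sub_preimage[OF P]])
    have ind_mult: "ind A * ind B = ind (A \<inter> B)" for A B :: "'b set"
      by (auto simp: ind_def fun_eq_iff)
    have "v * f \<in> ?P" if v: "v \<in> V" and f: "f \<in> pw V j" for v f
    proof -
      \<comment> \<open>Bilinearity is used one factor at a time: first \<open>v\<close> varies with
        \<open>ind B\<close> fixed, then the second factor varies.\<close>
      have "v * ind B \<in> ?P" if B: "B \<in> \<B> j" for B
      proof -
        have "V \<subseteq> {v. ind B * v \<in> ?P}"
          unfolding V_def
        proof (rule spn_minimal[OF ker], rule subsetI)
          fix w assume "w \<in> insert 1 (ind ` G)"
          then consider "w = 1" | A where "A \<in> G" "w = ind A" by blast
          then show "w \<in> {v. ind B * v \<in> ?P}"
          proof cases
            case 1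
            then show ?thesis using gen mono B by auto
          next
            case (2 A)
            then show ?thesis using gen[OF \<B>G[OF 2(1) B]] by (simp add: ind_mult Int_commute)
          qed
        qed
        then show ?thesis using v by (auto simp: mult.commute)
      qed
      then have "spn (ind ` \<B> j) \<subseteq> {f. v * f \<in> ?P}"
        by (intro spn_minimal[OF ker]) auto
      moreover obtain m where "m \<in> spn (ind ` \<B> j)" "eqv X f m"
        using Suc f by (auto simp: cl_def)
      ultimately show ?thesis using sub_eqv[OF P] eqv_mult by blast
    qed
    then show ?case unfolding pw.simps
      by (intro spn_minimal[OF sub_lin[OF P]]) auto
  qed
  have "(\<Sum>i\<in>X. f i) \<in> I" if f: "f \<in> pw V p" for f
  proof -
    \<comment> \<open>Vectors with sum in \<open>I\<close> form a linear space, so it suffices to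
      look at indicators, whose sums are cardinalities.\<close>
    have "spn (ind ` \<B> p) \<subseteq> {f. (\<Sum>i\<in>X. f i) \<in> I}"
    proof (rule spn_minimal)
      show "lin {f :: 'b \<Rightarrow> 'a. (\<Sum>i\<in>X. f i) \<in> I}"
        by (auto simp: lin_def zero_I add_I mult_I sum.distrib sum_distrib_left[symmetric])
      show "ind ` \<B> p \<subseteq> {f. (\<Sum>i\<in>X. f i) \<in> I}"
      proof clarify
        fix B assume B: "B \<in> \<B> p"
        have "p dvd card B" using \<B>E[OF B] dv div by blast
        moreover have "(\<Sum>i\<in>X. ind B i) = (of_nat (card B) :: 'a)"
          using \<B>X[OF B] X by (simp add: ind_def sum.If_cases Int_absorb1)
        ultimately show "(\<Sum>i\<in>X. ind B i) \<in> I" using of_nat_in_I_iff[OF p] by simp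
      qed
    qed
    moreover obtain m where m: "m \<in> spn (ind ` \<B> p)" "eqv X f m"
      using pwB f by (auto simp: cl_def)
    ultimately have "(\<Sum>i\<in>X. m i) \<in> I" by blast
    then have "(\<Sum>i\<in>X. f i) - (\<Sum>i\<in>X. m i) + (\<Sum>i\<in>X. m i) \<in> I"
      by (rule add_I[OF sum_eqv[OF m(2)]])
    then show ?thesis by simp
  qed
  then have le: "sz X V ^ p \<le> q ^ card X" using sz_power_le[OF p linV V(1) X large] by blast
  obtain d where d: "sz X V = q ^ d" "\<And>w. card (boolean_in X V w) \<le> 2 ^ d"
    using sz_power_boolean[OF X linV] by blast
  obtain m where m: "card X = p * m" using dv by blast
  have p0: "p > 0" using p prime_gt_0_nat by blast
  have "q ^ (d * p) \<le> q ^ card X" using le by (simp add: d power_mult)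
  then have "d * p \<le> p * m" using q_ge2 by (simp add: m power_increasing_iff)
  then have "d \<le> card X div p" using p0 m by simp
  then have "(2::nat) ^ d \<le> 2 ^ (card X div p)" by (rule power_increasing) simp
  then have "card (boolean_in X V 0) \<le> 2 ^ (card X div p)"
    by (rule order_trans[OF d(2)])
  then show ?thesis using V linV by blast
qed

end

section \<open>Large finite residue fields of characteristic p\<close>

definition poly_ideal :: "int poly set \<Rightarrow> bool" where
  "poly_ideal J \<longleftrightarrow> 0 \<in> J \<and> (\<forall>x\<in>J. \<forall>y\<in>J. x + y \<in> J) \<and> (\<forall>a. \<forall>x\<in>J. a * x \<in> J)"

lemma poly_idealI:
  "0 \<in> J \<Longrightarrow> (\<And>x y. x \<in> J \<Longrightarrow> y \<in> J \<Longrightarrow> x + y \<in> J) \<Longrightarrow>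
    (\<And>a x. x \<in> J \<Longrightarrow> a * x \<in> J) \<Longrightarrow> poly_ideal J"
  by (simp add: poly_ideal_def)

lemma poly_idealD:
  assumes "poly_ideal J"
  shows "0 \<in> J" "x \<in> J \<Longrightarrow> y \<in> J \<Longrightarrow> x + y \<in> J" "x \<in> J \<Longrightarrow> a * x \<in> J"
  using assms by (auto simp: poly_ideal_def)

lemma poly_ideal_diff: "poly_ideal J \<Longrightarrow> x \<in> J \<Longrightarrow> y \<in> J \<Longrightarrow> x - y \<in> J"
  using poly_idealD(2)[of J x "-1 * y"] poly_idealD(3)[of J y "-1"] by simp

text \<open>Zorn's lemma gives a maximal proper ideal above \<open>J\<close>; for \<open>x\<close>
  outside it, the ideal generated by \<open>M\<close> and \<open>x\<close> contains 1, which
  exhibits an inverse of \<open>x\<close>.\<close>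

lemma exists_maximal_poly_ideal:
  assumes J: "poly_ideal J" "1 \<notin> J"
  obtains M where "J \<subseteq> M" "poly_ideal M" "1 \<notin> M" "\<And>x. x \<notin> M \<Longrightarrow> \<exists>y. x * y - 1 \<in> M"
proof -
  define \<A> where "\<A> = {M. poly_ideal M \<and> J \<subseteq> M \<and> 1 \<notin> M}"
  have "\<exists>M\<in>\<A>. \<forall>N\<in>\<A>. M \<subseteq> N \<longrightarrow> N = M"
  proof (rule subset_Zorn_nonempty)
    show "\<A> \<noteq> {}" using J by (auto simp: \<A>_def)
    fix C assume C: "C \<noteq> {}" "subset.chain \<A> C"
    have CA: "poly_ideal M" "J \<subseteq> M" "1 \<notin> M" if "M \<in> C" for M
      using C(2) that by (auto simp: subset.chain_def \<A>_def)
    have "poly_ideal (\<Union>C)"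
    proof (rule poly_idealI)
      show "0 \<in> \<Union>C" using C(1) poly_idealD(1)[OF CA(1)] by blast
    next
      fix x y assume "x \<in> \<Union>C" "y \<in> \<Union>C"
      then obtain M N where MN: "M \<in> C" "x \<in> M" "N \<in> C" "y \<in> N" by blast
      then have "M \<subseteq> N \<or> N \<subseteq> M" using C(2) by (auto simp: subset.chain_def)
      then obtain K where K: "K \<in> C" "x \<in> K" "y \<in> K" using MN by blast
      then show "x + y \<in> \<Union>C" using poly_idealD(2)[OF CA(1)[OF K(1)]] by blast
    next
      fix a x assume "x \<in> \<Union>C"
      then show "a * x \<in> \<Union>C" using poly_idealD(3)[OF CA(1)] by blast
    qed
    then show "\<Union>C \<in> \<A>" using C(1) CA(2,3) unfolding \<A>_def by blast
  qed
  then obtain M where M: "M \<in> \<A>" and max: "\<And>N. N \<in> \<A> \<Longrightarrow> M \<subseteq> N \<Longrightarrow> N = M" by blast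
  have id: "poly_ideal M" "J \<subseteq> M" "1 \<notin> M" using M by (auto simp: \<A>_def)
  have "\<exists>y. x * y - 1 \<in> M" if x: "x \<notin> M" for x
  proof -
    define N where "N = {m + x * y |m y. m \<in> M}"
    have MN: "M \<subseteq> N"
    proof
      fix m assume "m \<in> M"
      moreover have "m = m + x * 0" by simp
      ultimately show "m \<in> N" unfolding N_def by blast
    qed
    have "x = 0 + x * 1" by simp
    then have "x \<in> N" unfolding N_def using poly_idealD(1)[OF id(1)] by blast
    then have "N \<noteq> M" using x by blast
    then have "N \<notin> \<A>" using max MN by blast
    moreover have "poly_ideal N"
    proof (rule poly_idealI)
      show "0 \<in> N" using MN poly_idealD(1)[OF id(1)] by blast
    next
      fix a b assume "a \<in> N" "b \<in> N"
      then obtain m y m' y' where ab: "m \<in> M" "a = m + x * y" "m' \<in> M" "b = m' + x * y'"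
        unfolding N_def by blast
      have "a + b = (m + m') + x * (y + y')" unfolding ab(2,4) by (simp only: ring_distribs ac_simps)
      then show "a + b \<in> N" unfolding N_def using poly_idealD(2)[OF id(1) ab(1,3)] by blast
    next
      fix c a assume "a \<in> N"
      then obtain m y where a: "m \<in> M" "a = m + x * y" unfolding N_def by blast
      have "c * a = c * m + x * (c * y)" unfolding a(2) by (simp only: ring_distribs ac_simps)
      then show "c * a \<in> N" unfolding N_def using poly_idealD(3)[OF id(1) a(1)] by blast
    qed
    ultimately have "1 \<in> N" using MN id(2) by (auto simp: \<A>_def)
    then obtain m y where m: "m \<in> M" "1 = m + x * y" unfolding N_def by blast
    have "x * y - 1 = -1 * m" using m(2) by (simp add: algebra_simps)
    then have "x * y - 1 \<in> M" using poly_idealD(3)[OF id(1) m(1), of "-1"] by simp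
    then show ?thesis by blast
  qed
  then show ?thesis using that id by blast
qed

text \<open>The leading coefficient of \<open>b\<close> survives in \<open>g * b\<close> at a degree
  that \<open>c\<close> does not reach, so \<open>p\<close> divides it and the leading term can be
  stripped off. This later shows that \<open>p\<close> and \<open>g\<close> generate a proper
  ideal.\<close>

lemma prime_dvd_of_monic_mult:
  fixes g b c :: "int poly"
  assumes p: "prime p" and g: "lead_coeff g = 1"
    and "[:p:] dvd g * b - c" "degree c < degree g"
  shows "[:p:] dvd b"
  using assms(3)
proof (induction "degree b" arbitrary: b rule: less_induct)
  case less
  show ?case
  proof (cases "b = 0")
    case False
    have lc: "coeff (g * b) (degree g + degree b) = lead_coeff b"
      using g by (simp add: coeff_mult_degree_sum)
    have "p dvd coeff (g * b - c) (degree g + degree b)"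
      using less.prems by (simp add: const_poly_dvd_iff)
    moreover have "coeff c (degree g + degree b) = 0"
      using assms(4) by (intro coeff_eq_0) simp
    ultimately have pl: "p dvd lead_coeff b" by (simp add: lc)
    define t where "t = monom (lead_coeff b) (degree b)"
    have pt: "[:p:] dvd t" using pl by (simp add: t_def const_poly_dvd_iff)
    have eq: "g * (b - t) - c = (g * b - c) - g * t" by (simp add: algebra_simps)
    have d: "[:p:] dvd g * (b - t) - c" unfolding eq 
      by (rule dvd_diff[OF less.prems dvd_mult[OF pt]])
    have "[:p:] dvd b - t"
    proof (cases "b - t = 0")
      case nz: False
      have "degree (b - t) < degree b"
      proof (rule degree_lessI)
        show "b - t \<noteq> 0 \<or> 0 < degree b" using nz by simp
        show "\<forall>k\<ge>degree b. coeff (b - t) k = 0"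
          by (auto simp: t_def coeff_eq_0)
      qed
      then show ?thesis using less.hyps d by blast
    qed simp
    then have "[:p:] dvd (b - t) + t" using pt by (rule dvd_add)
    then show ?thesis by simp
  qed simp
qed

text \<open>Division by the monic \<open>g\<close> bounds the degree, and reduction modulo
  \<open>p\<close> bounds the coefficients, so finitely many polynomials represent all
  classes.\<close>

lemma finite_poly_residues:
  fixes g :: "int poly"
  assumes J: "poly_ideal J" and p: "[:int p:] \<in> J" "p > 0" and g: "g \<in> J" "lead_coeff g = 1"
  shows "finite (range (\<lambda>x. {y. y - x \<in> J}))"
proof -
  define R where "R = {r :: int poly. degree r \<le> degree g \<and> (\<forall>k. coeff r k \<in> {0..<int p})}"
  have "finite R"
  proof -
    have "inj_on coeffs R" by (rule inj_onI) (simp add: coeffs_eq_iff)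
    moreover have "coeffs ` R \<subseteq> {xs. set xs \<subseteq> {0..<int p} \<and> length xs \<le> Suc (degree g)}"
    proof clarify
      fix r assume r: "r \<in> R"
      have "set (coeffs r) \<subseteq> range (coeff r)" by (auto simp: coeffs_def)
      then have "set (coeffs r) \<subseteq> {0..<int p}" using r by (auto simp: R_def)
      moreover have "length (coeffs r) \<le> Suc (degree g)"
        using r by (cases "r = 0") (auto simp: R_def length_coeffs_degree)
      ultimately show "set (coeffs r) \<subseteq> {0..<int p} \<and> length (coeffs r) \<le> Suc (degree g)" by simp
    qed
    ultimately show ?thesis
      using finite_lists_length_le[of "{0..<int p}" "Suc (degree g)"] inj_on_finite by blast
  qed
  have "\<exists>r\<in>R. x - r \<in> J" for x
  proof -
    obtain a r where ar: "pseudo_divmod x g = (a, r)" by (metis surj_pair)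
    have g0: "g \<noteq> 0" using g by auto
    \<comment> \<open>Pseudo-division scales \<open>x\<close> by a power of the leading coefficient
      of \<open>g\<close>, which is 1 here.\<close>
    have x: "x = g * a + r" and dr: "r = 0 \<or> degree r < degree g"
      using pseudo_divmod[OF g0 ar] g(2) by simp_all
    define s where "s = map_poly (\<lambda>c. c mod int p) r"
    have cs: "coeff s k = coeff r k mod int p" for k by (simp add: s_def coeff_map_poly)
    have "degree s \<le> degree r" unfolding s_def by (rule map_poly_degree_leq)
    then have "s \<in> R" using dr p(2) by (auto simp: R_def cs)
    moreover have "[:int p:] dvd r - s" by (simp add: const_poly_dvd_iff cs mod_eq_dvd_iff[symmetric])
    then obtain b where b: "r - s = [:int p:] * b" by blast
    have "x - s = a * g + b * [:int p:]" using x b by (simp add: algebra_simps)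
    then have "x - s \<in> J" using poly_idealD[OF J] p g by metis
    ultimately show ?thesis by blast
  qed
  then obtain \<rho> where \<rho>: "\<And>x. \<rho> x \<in> R \<and> x - \<rho> x \<in> J" by metis
  have "{y. y - x \<in> J} = {y. y - \<rho> x \<in> J}" for x
  proof -
    have "y - x \<in> J \<longleftrightarrow> y - \<rho> x \<in> J" for y
      using poly_idealD(2)[OF J, of "y - x" "x - \<rho> x"] poly_ideal_diff[OF J, of "y - \<rho> x" "x - \<rho> x"]
        \<rho>[of x] by auto
    then show ?thesis by blast
  qed
  then have "range (\<lambda>x. {y. y - x \<in> J}) \<subseteq> (\<lambda>x. {y. y - x \<in> J}) ` R" using \<rho> by blast
  then show ?thesis using \<open>finite R\<close> finite_surj by blast
qed

text \<open>Pairwise incongruent powers of the variable make the residue field as large as desired,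
  since \<open>N\<close> is arbitrary.\<close>

lemma exists_large_maximal_poly_ideal:
  assumes p: "prime (p :: nat)"
  obtains J where "poly_ideal J" "1 \<notin> J" "\<And>x. x \<notin> J \<Longrightarrow> \<exists>y. x * y - 1 \<in> J"
    "finite (range (\<lambda>x. {y. y - x \<in> J}))" "of_nat p \<in> J"
    "\<And>i j. 1 \<le> i \<Longrightarrow> i < j \<Longrightarrow> j \<le> N \<Longrightarrow> monom 1 j - monom 1 i \<notin> J"
proof -
  \<comment> \<open>As \<open>u\<close> will be congruent to \<open>1\<close>, its factors are not in \<open>J\<close>; as \<open>u - 1\<close> is monic, the residue
    ring is finite.\<close>
  define D where "D = {(i, j). 1 \<le> i \<and> i < j \<and> j \<le> N + 2}"
  define u :: "int poly" where "u = (\<Prod>(i, j)\<in>D. monom 1 j - monom 1 i)"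
  have "D \<subseteq> {..N + 2} \<times> {..N + 2}" by (auto simp: D_def)
  then have D: "finite D" by (rule finite_subset) simp
  have diff: "degree (monom 1 j - monom 1 i :: int poly) = j \<and> lead_coeff (monom 1 j - monom 1 i :: int poly) = 1"
    if "i < j" for i j
  proof -
    have "degree (monom 1 j - monom 1 i :: int poly) = j"
    proof (rule antisym)
      show "degree (monom 1 j - monom 1 i :: int poly) \<le> j"
        using that by (intro degree_diff_le) (auto simp: degree_monom_eq)
      show "j \<le> degree (monom 1 j - monom 1 i :: int poly)"
        using that by (intro le_degree) simp
    qed
    then show ?thesis using that by simp
  qed
  have lcu: "lead_coeff u = 1"
    unfolding u_def lead_coeff_prod by (rule prod.neutral) (use diff in \<open>auto simp: D_def\<close>)
  have dvd: "monom 1 j - monom 1 i dvd u" if "(i, j) \<in> D" for i j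
    using dvd_prodI[OF D that, of "\<lambda>(i, j). monom 1 j - monom 1 i"] by (simp add: u_def)
  have "degree u \<noteq> 0"
  proof
    assume "degree u = 0"
    \<comment> \<open>The bound \<open>N + 2\<close> in \<open>D\<close> admits this pair for every
      \<open>N\<close>, so \<open>u\<close> is not constant and \<open>u - 1\<close> stays
      monic.\<close>
    have "(1, 2) \<in> D" by (simp add: D_def)
    then have "monom 1 2 - monom 1 1 dvd u" by (rule dvd)
    moreover have "u \<noteq> 0" using lcu by auto
    ultimately have "degree (monom 1 2 - monom 1 1 :: int poly) \<le> degree u" by (rule dvd_imp_degree_le)
    then show False using \<open>degree u = 0\<close> diff[of 1 2] by simp
  qed
  define g where "g = u - 1"
  have dg: "degree g = degree u"
    unfolding g_def diff_conv_add_uminus using \<open>degree u \<noteq> 0\<close> by (intro degree_add_eq_left) simp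
  have lcg: "lead_coeff g = 1"
    using lcu \<open>degree u \<noteq> 0\<close> unfolding dg by (simp add: g_def)
  define J0 where "J0 = {[:int p:] * a + g * b |a b. True}"
  have "poly_ideal J0"
  proof (rule poly_idealI)
    show "0 \<in> J0" unfolding J0_def by (intro CollectI exI[of _ 0]) simp
  next
    fix x y assume "x \<in> J0" "y \<in> J0"
    then obtain a b a' b' where "x = [:int p:] * a + g * b" "y = [:int p:] * a' + g * b'"
      unfolding J0_def by blast
    then have "x + y = [:int p:] * (a + a') + g * (b + b')" by (simp only: ring_distribs ac_simps)
    then show "x + y \<in> J0" unfolding J0_def by blast
  next
    fix c x assume "x \<in> J0"
    then obtain a b where "x = [:int p:] * a + g * b" unfolding J0_def by blast
    then have "c * x = [:int p:] * (c * a) + g * (c * b)" by (simp only: ring_distribs ac_simps)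
    then show "c * x \<in> J0" unfolding J0_def by blast
  qed
  \<comment> \<open>Otherwise \<open>g * b\<close> would be congruent to 1 modulo \<open>p\<close>,
    although \<open>g\<close> is monic of positive degree; then \<open>p\<close> divides
    \<open>b\<close>, and hence 1.\<close>
  moreover have "1 \<notin> J0"
  proof
    assume "1 \<in> J0"
    then obtain a b where ab: "1 = [:int p:] * a + g * b" unfolding J0_def by blast
    have "g * b - 1 = [:int p:] * (- a)" using ab by (simp add: algebra_simps)
    then have "[:int p:] dvd g * b - 1" by (rule dvdI)
    then have "[:int p:] dvd b"
      using p lcg \<open>degree u \<noteq> 0\<close> dg by (intro prime_dvd_of_monic_mult[of "int p" g b 1]) simp_all
    then have "[:int p:] dvd [:int p:] * a + g * b" by (intro dvd_add dvd_mult dvd_triv_left)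
    then have "[:int p:] dvd 1" unfolding ab[symmetric] .
    then have "int p dvd coeff 1 0" unfolding const_poly_dvd_iff by blast
    then have "int p dvd 1" by simp
    then show False using p by (metis int_dvd_int_iff not_prime_unit of_nat_1)
  qed
  ultimately obtain J where J: "J0 \<subseteq> J" "poly_ideal J" "1 \<notin> J" "\<And>x. x \<notin> J \<Longrightarrow> \<exists>y. x * y - 1 \<in> J"
    using exists_maximal_poly_ideal by blast
  have "[:int p:] = [:int p:] * 1 + g * 0" "g = [:int p:] * 0 + g * 1" by simp_all
  then have pJ: "[:int p:] \<in> J" and gJ: "g \<in> J" using J(1) unfolding J0_def by blast+
  have "monom 1 j - monom 1 i \<notin> J" if ij: "1 \<le> i" "i < j" "j \<le> N" for i j
  proof
    assume m: "monom 1 j - monom 1 i \<in> J"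
    have "(i, j) \<in> D" using ij by (simp add: D_def)
    then obtain c where "u = (monom 1 j - monom 1 i) * c" using dvd by blast
    then have "u \<in> J" using poly_idealD(3)[OF J(2) m, of c] by (simp add: mult.commute)
    then have "u - g \<in> J" using gJ by (rule poly_ideal_diff[OF J(2)])
    then show False using J(3) by (simp add: g_def)
  qed
  moreover have "finite (range (\<lambda>x. {y. y - x \<in> J}))"
    using finite_poly_residues[OF J(2) pJ _ gJ lcg] p prime_gt_0_nat by blast
  moreover have "of_nat p \<in> J" using pJ by (simp add: of_nat_poly)
  ultimately show ?thesis using that J by blast
qed

section \<open>The bound for set families\<close>

theorem theorem1p1:
  fixes p n :: nat and F :: "nat set set"
  assumes "prime p" and "n \<ge> 1"
    and "F \<subseteq> Pow {1..n}"
    and "kwise_divisible p p F"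
  shows "card F \<le> 2 ^ (n div p)"
proof -
  have p0: "p > 0" using assms(1) prime_gt_0_nat by blast
  define N where "N = (if p dvd n then n else p * Suc (n div p))"
  define X where "X = {1..N}"
  have X: "finite X" "card X = N" "p dvd N" by (auto simp: X_def N_def)
  have nN: "n \<le> N"
    using dividend_less_times_div[OF p0, of n] by (auto simp: N_def)
  have FX: "A \<subseteq> X" if "A \<in> F" for A
  proof -
    have "A \<subseteq> {1..n}" using assms(3) that by blast
    also have "\<dots> \<subseteq> X" using nN by (auto simp: X_def)
    finally show ?thesis .
  qed
  \<comment> \<open>The first \<open>L\<close> powers of the variable will be pairwise incongruent,
    so \<open>q\<close> is at least \<open>L\<close> and thus exceeds
    \<open>2 ^ N + N\<close>.\<close>
  define L where "L = 2 ^ N + N + 1"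
  obtain J where J: "poly_ideal J" "1 \<notin> J" "\<And>x. x \<notin> J \<Longrightarrow> \<exists>y. x * y - 1 \<in> J"
    "finite (range (\<lambda>x. {y. y - x \<in> J}))" "of_nat p \<in> J"
    and dist: "\<And>i j. 1 \<le> i \<Longrightarrow> i < j \<Longrightarrow> j \<le> L \<Longrightarrow> monom 1 j - monom 1 i \<notin> J"
    using exists_large_maximal_poly_ideal[OF assms(1)] by metis
  interpret finite_residue_field J
    using poly_idealD[OF J(1)] J(2-4) by unfold_locales
  have "inj_on (\<lambda>i. repr (monom 1 i)) {1..L}"
  proof (rule linorder_inj_onI)
    fix i j assume "i < j" "i \<in> {1..L}" "j \<in> {1..L}"
    then have "repr (monom 1 j) \<noteq> repr (monom 1 i)" unfolding repr_eq_iff by (intro dist) simp_all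
    then show "repr (monom 1 i) \<noteq> repr (monom 1 j)" by simp
  qed auto
  then have "L \<le> card (range repr)"
    using card_inj_on_le[of "\<lambda>i. repr (monom 1 i)" "{1..L}" "range repr"] finite_range_repr by auto
  then have large: "2 ^ card X + card X < q" by (simp add: q_def X L_def)
  have div: "p dvd card (\<Inter>i\<in>{1..j}. A i)"
    if j: "1 \<le> j" "j \<le> p" and A: "\<And>i. i \<in> {1..j} \<Longrightarrow> A i \<in> F" for j A
  proof -
    \<comment> \<open>A shorter sequence is extended to length \<open>p\<close> by repeating its
      last set, which leaves the intersection unchanged.\<close>
    have "(\<Inter>i\<in>{1..p}. A (min i j)) = (\<Inter>i\<in>{1..j}. A i)"
    proof -
      have "(\<lambda>i. min i j) ` {1..p} = {1..j}"
      proof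
        show "{1..j} \<subseteq> (\<lambda>i. min i j) ` {1..p}"
        proof
          fix i assume "i \<in> {1..j}"
          then show "i \<in> (\<lambda>i. min i j) ` {1..p}" using j by (intro image_eqI[of _ _ i]) auto
        qed
      qed (use j in auto)
      then show ?thesis by (metis image_image)
    qed
    moreover have "\<forall>i\<in>{1..p}. A (min i j) \<in> F" using j A by simp
    ultimately show ?thesis using assms(4) unfolding kwise_divisible_def by metis
  qed
  have "p dvd card X" using X by simp
  from boolean_family_bound[OF assms(1) J(5) X(1) large this FX div]
  obtain V where V: "lin V" "1 \<in> V" "\<And>A. A \<in> F \<Longrightarrow> ind A \<in> V"
    and le: "card (boolean_in X V 0) \<le> 2 ^ (card X div p)"
    by blast
  have fin: "finite (boolean_in X V 0)" unfolding boolean_in_def using X(1) by simp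
  have sub: "F \<subseteq> boolean_in X V 0"
    using FX V(3) eqv_refl unfolding boolean_in_def by fastforce
  show ?thesis
  proof (cases "p dvd n")
    case True
    then have "N = n" by (simp add: N_def)
    then show ?thesis using card_mono[OF fin sub] le X(2) by simp
  next
    case False
    then have N: "N div p = Suc (n div p)" "n < N"
      using p0 dividend_less_times_div[OF p0, of n] by (simp_all add: N_def)
    have "(\<lambda>A. X - A) ` F \<subseteq> boolean_in X V 0"
    proof clarify
      fix A assume A: "A \<in> F"
      have "eqv X (ind (X - A)) (1 - ind A + 0)"
        by (auto simp: eqv_def ind_def zero_I)
      moreover have "1 - ind A \<in> V" using V A lin_diff by blast
      ultimately show "X - A \<in> boolean_in X V 0" unfolding boolean_in_def by blast
    qed
    \<comment> \<open>Padding raises the exponent by one, which the doubling of the family will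
      cancel.\<close>
    then have "card (F \<union> (\<lambda>A. X - A) ` F) \<le> 2 ^ Suc (n div p)"
      using card_mono[OF fin, of "F \<union> (\<lambda>A. X - A) ` F"] sub le X(2) N(1) by simp
    moreover have "card (F \<union> (\<lambda>A. X - A) ` F) = card F + card F"
    proof -
      have fF: "finite F" using finite_subset[OF sub fin] .
      \<comment> \<open>The padding element \<open>N\<close> lies in every complement and in no
        member of \<open>F\<close>, so the complements are new sets.\<close>
      have "N \<notin> A" if "A \<in> F" for A
      proof -
        have "A \<subseteq> {1..n}" using assms(3) that by blast
        then show ?thesis using N(2) by auto
      qed
      moreover have "N \<in> X" using N(2) by (simp add: X_def)
      ultimately have "F \<inter> (\<lambda>A. X - A) ` F = {}" by blast
      moreover have "inj_on (\<lambda>A. X - A) F"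
        by (rule inj_onI) (use FX in blast)
      ultimately show ?thesis using fF by (simp add: card_Un_disjoint card_image)
    qed
    ultimately show ?thesis by simp
  qed
qed

end
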